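(* (a) Let $d\in\mathbb N$, $\beta>0$, $a>0$, $\alpha\le0$ and $\mu\in\mathbb R$. The rate function $I^{\mathrm{PMF}}_{\alpha,\mu}$ has a unique zero at $\xi^{\mathrm{PMF}}\in\ell_1(\mathbb R_+)$, where $$\xi^{\mathrm{PMF}}_k=q_k^{(\alpha)}\exp\big(\beta k(\mu-a\delta^* )_-\big),\qquad k\in\mathbb N,$$ and $\delta^*=\delta^*(\beta,\alpha,\mu,a)$ is given implicitly as the unique solution to the equation $$\delta^*=\sum_{k=1}^\infty kq_k^{(\alpha)}\exp\big(\beta k(\mu-a\delta^* )_-\big)=D(\xi^{\mathrm{PMF}}).$$ Moreover: for $\mu\le0$, $\delta^*\in(0,\varrho(\alpha+\mu-a\delta^* ))$; for $\mu>0$, $\delta^*\in(\mu/a,\varrho(\alpha))$ if $\mu<a\varrho(\alpha)$, and $\delta^*=\varrho(\alpha)$ if $\mu\ge a\varrho(\alpha)$. Here $\varrho(\alpha)=\sum_{k\in\mathbb N}kq_k^{(\alpha)}$ for $\alpha\le0$. (b) Let $\beta>0$, $\alpha\le0$, $\mu\in\mathbb R$ and $a\ge0$. Then $$p^{\mathrm{PMF}}(\beta,\alpha,\mu)=\begin{cases}p(\beta,\alpha)+\dfrac{\mu^2}{2a},&\text{for }\mu\ge a\varrho(\alpha),\ \delta^*=\varrho(\alpha),\\[6pt]\dfrac a2(\delta^* )^2+p(\beta,\alpha+\mu-a\delta^* ),&\text{for }\mu<a\varrho(\alpha),\ \delta^*\in(\mu/a,\varrho(\alpha)).\end{cases}$$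 (c) For $\beta>0$ and $\alpha\le0$, the pressure $p^{\mathrm{PMF}}(\beta,\alpha,\cdot)$ belongs to $C^1(\mathbb R)$ and is convex. In particular, $$\frac{\mathrm dp^{\mathrm{PMF}}}{\mathrm d\mu}=\begin{cases}\varrho(\alpha+\mu-a\delta^* ),&\text{for }\mu<a\varrho(\alpha),\ \delta^*\in(\mu/a,\varrho(\alpha)),\\\mu/a,&\text{for }\mu\ge a\varrho(\alpha),\ \delta^*=\varrho(\alpha),\end{cases}$$ where $\delta^*$ is the solution of the equation in (a).
   Context: $|\Lambda_N|=(2N)^d$ for $d,N\in\mathbb N=\{1,2,\dots\}$. For $\alpha\le0$ and $k\in\mathbb N$: $q_k^{(\alpha)}=\frac{e^{\beta k\alpha}}{(4\pi\beta)^{d/2}k^{1+d/2}}$, $\bar q^{(\alpha)}=\sum_{k\in\mathbb N}q_k^{(\alpha)}$, and $p(\beta,\alpha)=\bar q^{(\alpha)}/\beta$ (the ideal Bose gas pressure); $\varrho(\alpha)\in(0,\infty]$. $(t)_-=\min\{t,0\}$. $\ell_1(\mathbb R_+)$ is the space of nonnegative summable real sequences and $D(x)=\sum_{k\ge1}kx_k\in[0,\infty]$. Let $(\mathcal N_k)_{k\in\mathbb N}$ be independent Poisson random variables, $\mathcal N_k$ having parameter $|\Lambda_N|q_k^{(\alpha)}$; $\nu_{N,\alpha}$ is the law on $\ell_1(\mathbb R_+)$ of $(\mathcal N_k/|\Lambda_N|)_{k\in\mathbb N}$. Define $$I_\alpha(x)=\sum_{k=1}^\infty\frac{x_k}{\beta}\Big(\log\frac{x_k}{q_k^{(\alpha)}}-1\Big)+\frac{\bar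 q^{(\alpha)}}{\beta}\ (0\log0=0),\qquad H^{\mathrm{PMF}}_\mu(x)=-\mu D(x)+\frac a2D(x)^2,$$ $$H^{\mathrm{PMF}}_{\mu,\mathrm{lsc}}(x)=\begin{cases}-\mu D(x)+\frac a2D(x)^2,&D(x)\ge\mu/a,\\-\frac{\mu^2}{2a},&D(x)<\mu/a\end{cases}$$ ($=+\infty$ if $D(x)=\infty$). The rate function of the particle-mean-field (PMF) model with coupling constant $a$ is $$I^{\mathrm{PMF}}_{\alpha,\mu}(x)=I_\alpha(x)+H^{\mathrm{PMF}}_{\mu,\mathrm{lsc}}(x)-\inf_{y\in\ell_1(\mathbb R_+)}\{I_\alpha(y)+H^{\mathrm{PMF}}_{\mu,\mathrm{lsc}}(y)\}.$$ With $Z_N^{\mathrm{PMF}}(\beta,\alpha,\mu)=\mathbb E_{\nu_{N,\alpha}}[e^{-\beta|\Lambda_N|H^{\mathrm{PMF}}_\mu}]$, the limiting pressure is $$p^{\mathrm{PMF}}(\beta,\alpha,\mu)=\lim_{N\to\infty}\frac1{\beta|\Lambda_N|}\log Z_N^{\mathrm{PMF}}(\beta,\alpha,\mu)=-\inf_{y\in\ell_1(\mathbb R_+)}\big\{I_\alpha(y)+H^{\mathrm{PMF}}_{\mu,\mathrm{lsc}}(y)\big\}.$$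
   Formalization: For μ≤0 the endpoint δ*=ϱ(α+μ−aδ* ) is allowed; (b) reads p^PMF+p(β,α)=printed value; p^PMF means −inf{…}, shown to be the limit only if α=0 or μ≤aϱ(α); (c) takes a>0; at a=0, μ/a and μ²/(2a) are ±∞ or 0, 0·∞=0, and δ*=ϱ(α) needs ϱ(α)<∞. *)

theory Defs
  imports "HOL-Probability.Probability"
begin

text \<open>
  Sequences indexed by \<open>k = 1, 2, \<dots>\<close> are functions \<open>nat \<Rightarrow> real\<close> vanishing at \<open>0\<close>, and sums
  over \<open>k \<ge> 1\<close> are written with \<open>Suc k\<close>. Quantities that may be infinite live in \<^typ>\<open>ereal\<close>,
  where \<open>0 * \<infinity> = 0\<close>, \<open>x / 0 = \<infinity>\<close> for \<open>x > 0\<close>, \<open>x / 0 = -\<infinity>\<close> for \<open>x < 0\<close> and \<open>0 / 0 = 0\<close>;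
  these conventions matter only for the coupling constant \<open>a = 0\<close>.
\<close>

definition vol :: "nat \<Rightarrow> nat \<Rightarrow> real" where
  "vol d N = (2 * real N) ^ d"

definition q :: "nat \<Rightarrow> real \<Rightarrow> real \<Rightarrow> nat \<Rightarrow> real" where
  "q d \<beta> \<alpha> k =
     exp (\<beta> * real k * \<alpha>) / ((4 * pi * \<beta>) powr (real d / 2) * real k powr (1 + real d / 2))"

definition qbar :: "nat \<Rightarrow> real \<Rightarrow> real \<Rightarrow> real" where
  "qbar d \<beta> \<alpha> = (\<Sum>k. q d \<beta> \<alpha> (Suc k))"

definition p_ideal :: "nat \<Rightarrow> real \<Rightarrow> real \<Rightarrow> real" where
  "p_ideal d \<beta> \<alpha> = qbar d \<beta> \<alpha> / \<beta>"

definition varrho :: "nat \<Rightarrow> real \<Rightarrow> real \<Rightarrow> ereal" where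
  "varrho d \<beta> \<alpha> = (\<Sum>k. ereal (real (Suc k) * q d \<beta> \<alpha> (Suc k)))"

definition l1_plus :: "(nat \<Rightarrow> real) set" where
  "l1_plus = {x. x 0 = 0 \<and> (\<forall>k. 0 \<le> x k) \<and> summable x}"

definition D :: "(nat \<Rightarrow> real) \<Rightarrow> ereal" where
  "D x = (\<Sum>k. ereal (real (Suc k) * x (Suc k)))"

text \<open>
  On \<^const>\<open>l1_plus\<close> the terms are bounded below by \<open>- q d \<beta> \<alpha> k / \<beta>\<close>, which is summable, so the
  series always converges in \<^typ>\<open>ereal\<close>. The factor \<open>x k\<close> takes care of \<open>0 log 0 = 0\<close>.
\<close>
definition I_rate :: "nat \<Rightarrow> real \<Rightarrow> real \<Rightarrow> (nat \<Rightarrow> real) \<Rightarrow> ereal" where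
  "I_rate d \<beta> \<alpha> x =
     (\<Sum>k. ereal (x (Suc k) / \<beta> * (ln (x (Suc k) / q d \<beta> \<alpha> (Suc k)) - 1)))
       + ereal (qbar d \<beta> \<alpha> / \<beta>)"

definition H_PMF :: "real \<Rightarrow> real \<Rightarrow> (nat \<Rightarrow> real) \<Rightarrow> ereal" where
  "H_PMF \<mu> a x =
     (if D x = \<infinity> then \<infinity> else - (ereal \<mu> * D x) + ereal (a / 2) * (D x)\<^sup>2)"

definition H_PMF_lsc :: "real \<Rightarrow> real \<Rightarrow> (nat \<Rightarrow> real) \<Rightarrow> ereal" where
  "H_PMF_lsc \<mu> a x =
     (if D x = \<infinity> then \<infinity>
      else if ereal \<mu> / ereal a \<le> D x then - (ereal \<mu> * D x) + ereal (a / 2) * (D x)\<^sup>2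
      else - (ereal (\<mu>\<^sup>2) / ereal (2 * a)))"

definition I_PMF :: "nat \<Rightarrow> real \<Rightarrow> real \<Rightarrow> real \<Rightarrow> real \<Rightarrow> (nat \<Rightarrow> real) \<Rightarrow> ereal" where
  "I_PMF d \<beta> \<alpha> \<mu> a x =
     I_rate d \<beta> \<alpha> x + H_PMF_lsc \<mu> a x
       - (INF y\<in>l1_plus. I_rate d \<beta> \<alpha> y + H_PMF_lsc \<mu> a y)"

text \<open>
  The variational formula for the limiting pressure. It agrees with the limit of
  \<open>log Z / (\<beta> * vol)\<close> for the partition function \<open>Z_PMF\<close> below if \<open>\<alpha> = 0\<close> or
  \<open>\<mu> \<le> a * varrho \<alpha>\<close>. If \<open>a > 0\<close>, \<open>\<alpha> < 0\<close> and \<open>\<mu> > a * varrho \<alpha>\<close>, moving mass to infinitely long cycles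
  costs nothing for the regularised \<^const>\<open>H_PMF_lsc\<close> but is exponentially expensive in
  \<open>Z_PMF\<close>, and the limit is strictly smaller.
\<close>
definition p_PMF :: "nat \<Rightarrow> real \<Rightarrow> real \<Rightarrow> real \<Rightarrow> real \<Rightarrow> ereal" where
  "p_PMF d \<beta> \<alpha> \<mu> a = - (INF y\<in>l1_plus. I_rate d \<beta> \<alpha> y + H_PMF_lsc \<mu> a y)"

text \<open>
  The law of the rescaled Poisson sequence. The sequence belongs to \<^const>\<open>l1_plus\<close> only almost
  surely, hence the law is formed on all sequences and then restricted; the trace of the product
  \<open>\<sigma>\<close>-algebra is the Borel \<open>\<sigma>\<close>-algebra of the \<open>\<ell>\<^sub>1\<close>-norm.
\<close>
definition nu :: "nat \<Rightarrow> real \<Rightarrow> real \<Rightarrow> nat \<Rightarrow> (nat \<Rightarrow> real) measure" where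
  "nu d \<beta> \<alpha> N = restrict_space
     (distr (\<Pi>\<^sub>M k\<in>{1..}. measure_pmf (poisson_pmf (vol d N * q d \<beta> \<alpha> k)))
            (\<Pi>\<^sub>M k\<in>UNIV. borel)
            (\<lambda>n k. if k = 0 then 0 else real (n k) / vol d N))
     l1_plus"

definition exp_ext :: "ereal \<Rightarrow> ennreal" where
  "exp_ext x = (if x = \<infinity> then \<infinity> else if x = -\<infinity> then 0 else ennreal (exp (real_of_ereal x)))"

definition log_ext :: "ennreal \<Rightarrow> ereal" where
  "log_ext z = (if z = \<infinity> then \<infinity> else if z = 0 then -\<infinity> else ereal (ln (enn2real z)))"

definition Z_PMF :: "nat \<Rightarrow> real \<Rightarrow> real \<Rightarrow> real \<Rightarrow> real \<Rightarrow> nat \<Rightarrow> ennreal" where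
  "Z_PMF d \<beta> \<alpha> \<mu> a N =
     (\<integral>\<^sup>+x. exp_ext (- (ereal (\<beta> * vol d N) * H_PMF \<mu> a x)) \<partial>nu d \<beta> \<alpha> N)"

definition delta_eq :: "nat \<Rightarrow> real \<Rightarrow> real \<Rightarrow> real \<Rightarrow> real \<Rightarrow> real \<Rightarrow> bool" where
  "delta_eq d \<beta> \<alpha> \<mu> a \<delta> \<longleftrightarrow>
     ereal \<delta> = (\<Sum>k. ereal (real (Suc k) * q d \<beta> \<alpha> (Suc k)
                             * exp (\<beta> * real (Suc k) * min (\<mu> - a * \<delta>) 0)))"

definition delta_star :: "nat \<Rightarrow> real \<Rightarrow> real \<Rightarrow> real \<Rightarrow> real \<Rightarrow> real" where
  "delta_star d \<beta> \<alpha> \<mu> a = (THE \<delta>. delta_eq d \<beta> \<alpha> \<mu> a \<delta>)"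

definition xi_PMF :: "nat \<Rightarrow> real \<Rightarrow> real \<Rightarrow> real \<Rightarrow> real \<Rightarrow> nat \<Rightarrow> real" where
  "xi_PMF d \<beta> \<alpha> \<mu> a k =
     (if k = 0 then 0
      else q d \<beta> \<alpha> k * exp (\<beta> * real k * min (\<mu> - a * delta_star d \<beta> \<alpha> \<mu> a) 0))"

end

theory Submission
  imports Defs "HOL-Real_Asymp.Real_Asymp"
begin

text \<open>
  Everything rests on one convexity argument. Replacing the quadratic energy by its tangent at a
  density \<open>m\<close> leaves an energy that is affine in the density \<open>D\<close>, and an affine energy of slope
  \<open>- \<theta>\<close> only shifts the chemical potential of the ideal gas from \<open>\<alpha>\<close> to \<open>\<alpha> + \<theta>\<close>: the Poisson
  intensities \<open>q\<close> get multiplied by \<open>exp (\<beta> * k * \<theta>)\<close>, and the rate function changes by \<open>\<theta> * D\<close> and a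
  difference of ideal pressures (\<open>I_rate_tilt\<close>). With \<open>\<theta> = \<mu> - a * m \<le> 0\<close> the tangent is a lower bound
  also for the regularised energy, so that

    \<open>I_\<alpha> + H_lsc \<ge> I_(\<alpha> + \<theta>) - (a / 2 * m\<^sup>2 + p (\<alpha> + \<theta>) - p \<alpha>)\<close>    (\<open>I_plus_H_ge\<close>).

  The rate function on the right is nonnegative, and it vanishes only at the ideal gas profile of
  chemical potential \<open>\<alpha> + \<theta>\<close>. There the bound is sharp if the tangent touches the energy at the
  density of this profile. That condition is the equation for \<open>\<delta>\<close>, with \<open>m = max \<delta> (\<mu> / a)\<close>. It is
  solved by monotonicity and the intermediate value theorem, and it gives the unique minimiser and
  the value of the infimum (\<open>I_PMF_eq_0_iff\<close>, \<open>p_PMF_eq_mf_dual\<close>).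

  The pressure is therefore a minimum over \<open>m\<close> of explicit functions. If \<open>\<mu>\<close> and \<open>m\<close> are changed
  together so that \<open>\<theta>\<close> stays fixed, only a square changes. This shows that the pressure deviates from
  its tangent of slope \<open>m\<close> by at most a quadratic amount. Since \<open>m\<close> is a nondecreasing Lipschitz
  function of \<open>\<mu>\<close>, the pressure is convex and continuously differentiable with derivative \<open>m\<close>.

  For the partition function, the same tangent inside the expectation yields an exponential moment
  that factorises, and hence an upper bound in every finite volume (\<open>Z_PMF_le\<close>). For the lower bound
  it suffices to look at the probability of a single configuration: by Stirling's formula the atom
  that rounds a profile with finitely many cycle lengths has, on the exponential scale, the
  probability predicted by the rate function (\<open>log_partition_ge_trial\<close>). Truncations of the
  minimiser are good profiles unless part of the density has condensed. In that case the limit is claimed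
  for \<open>\<alpha> = 0\<close> only, and the missing density is put into very long cycles, whose entropic cost per volume tends to \<open>0\<close>
  (\<open>long_cycle_cost\<close>).
\<close>

section \<open>Relative entropy of Poisson parameters\<close>

text \<open>
  The relative entropy of the Poisson law with mean \<open>x\<close> with respect to the one with mean \<open>r\<close>.
\<close>

definition rel_ent :: "real \<Rightarrow> real \<Rightarrow> real" where
  "rel_ent x r = x * ln (x / r) - x + r"

lemma rel_ent_nonneg:
  assumes "0 \<le> x" "0 < r"
  shows "0 \<le> rel_ent x r"
proof (cases "x = 0")
  case True
  then show ?thesis using assms by (simp add: rel_ent_def)
next
  case False
  then have x: "0 < x" using assms by simp
  have "ln (r / x) \<le> r / x - 1" using x assms by (intro ln_le_minus_one) simp
  then have "x * ln (r / x) \<le> x * (r / x - 1)" using x by simp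
  also have "\<dots> = r - x" using x by (simp add: field_simps)
  finally show ?thesis using x assms by (simp add: rel_ent_def ln_div algebra_simps)
qed

lemma rel_ent_eq_0_iff:
  assumes "0 \<le> x" "0 < r"
  shows "rel_ent x r = 0 \<longleftrightarrow> x = r"
proof
  assume eq: "rel_ent x r = 0"
  have x: "0 < x" using eq assms by (cases "x = 0") (auto simp: rel_ent_def)
  have "x * ln (r / x) = x * (r / x - 1)"
    using eq x assms by (simp add: rel_ent_def ln_div algebra_simps)
  then have "ln (r / x) = r / x - 1" using x by (simp only: mult_cancel_left) simp
  then have "r / x = 1" using ln_eq_minus_one[of "r / x"] x assms by simp
  then show "x = r" using x by simp
next
  assume "x = r" then show "rel_ent x r = 0" using assms by (simp add: rel_ent_def)
qed

lemma rel_ent_self: "0 < r \<Longrightarrow> rel_ent r r = 0"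
  by (simp add: rel_ent_def)

text \<open>
  Multiplying the reference intensity by \<open>exp t\<close> changes the relative entropy only by a function
  affine in \<open>x\<close>. This is the exponential change of measure for Poisson variables, and the
  linear part is what absorbs a linear energy.
\<close>

lemma rel_ent_tilt:
  assumes "0 \<le> x" "0 < r"
  shows "rel_ent x r = rel_ent x (r * exp t) + (t * x - (r * exp t - r))"
proof (cases "x = 0")
  case False
  then have "ln (x / (r * exp t)) = ln (x / r) - t"
    using assms by (simp add: ln_div ln_mult)
  then show ?thesis unfolding rel_ent_def by (simp only:) (simp add: algebra_simps)
qed (simp add: rel_ent_def)

section \<open>Weights of the ideal Bose gas\<close>

lemma varrho_eq_D: "varrho d \<beta> \<gamma> = D (q d \<beta> \<gamma>)"
  by (simp add: varrho_def D_def)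

text \<open>
  A weight \<open>exp (\<beta> * \<theta>)\<close> per particle is the same as a shift of the chemical potential \<open>\<alpha>\<close>, because a
  cycle of length \<open>k\<close> carries \<open>k\<close> particles.
\<close>

lemma q_tilt: "q d \<beta> (\<alpha> + \<theta>) k = q d \<beta> \<alpha> k * exp (\<beta> * real k * \<theta>)"
  by (simp only: q_def distrib_left exp_add) simp

lemma D_nonneg: "x \<in> l1_plus \<Longrightarrow> 0 \<le> D x"
  unfolding D_def l1_plus_def by (rule suminf_0_le) simp

lemma D_finite_iff:
  assumes "\<And>k. 0 \<le> x (Suc k)"
  shows "D x = ereal s \<longleftrightarrow> (\<lambda>k. real (Suc k) * x (Suc k)) sums s"
proof
  assume D: "D x = ereal s"
  have "(\<lambda>k. ereal (real (Suc k) * x (Suc k))) sums D x"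
    unfolding D_def by (intro summable_sums summable_ereal_pos) (use assms in simp)
  then show "(\<lambda>k. real (Suc k) * x (Suc k)) sums s"
    by (simp only: D sums_ereal)
next
  assume "(\<lambda>k. real (Suc k) * x (Suc k)) sums s"
  then have "(\<lambda>k. ereal (real (Suc k) * x (Suc k))) sums ereal s" by (simp only: sums_ereal)
  then show "D x = ereal s" unfolding D_def by (rule sums_unique[symmetric])
qed

locale bose_gas =
  fixes d :: nat and \<beta> :: real
  assumes dim_pos: "1 \<le> d" and beta_pos: "0 < \<beta>"
begin

text \<open>
  The \<open>d\<close>-th power of the thermal wavelength.
\<close>

definition thermal_volume :: real where "thermal_volume = (4 * pi * \<beta>) powr (real d / 2)"

lemma thermal_volume_pos: "0 < thermal_volume"
  using beta_pos by (simp add: thermal_volume_def)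

lemma q_pos: "0 < q d \<beta> \<gamma> (Suc k)"
  using beta_pos by (simp add: q_def)

lemma q_mono:
  assumes "\<gamma> \<le> \<gamma>'"
  shows "q d \<beta> \<gamma> k \<le> q d \<beta> \<gamma>' k"
proof -
  have "\<beta> * real k * \<gamma> \<le> \<beta> * real k * \<gamma>'"
    using assms beta_pos by (intro mult_left_mono) simp_all
  then show ?thesis unfolding q_def by (intro divide_right_mono) simp_all
qed

lemma q_strict_mono:
  assumes "\<gamma> < \<gamma>'"
  shows "q d \<beta> \<gamma> (Suc k) < q d \<beta> \<gamma>' (Suc k)"
proof -
  have "\<beta> * real (Suc k) * \<gamma> < \<beta> * real (Suc k) * \<gamma>'"
    using assms beta_pos by (intro mult_strict_left_mono) simp_all
  then show ?thesis unfolding q_def using beta_pos by (intro divide_strict_right_mono) simp_all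
qed

lemma q_summable:
  assumes "\<gamma> \<le> 0"
  shows "summable (\<lambda>k. q d \<beta> \<gamma> (Suc k))"
proof (rule summable_comparison_test'[where N=0])
  have "summable (\<lambda>k. real k powr (- (1 + real d / 2)))"
    using dim_pos by (simp add: summable_real_powr_iff)
  then have "summable (\<lambda>k. real (Suc k) powr (- (1 + real d / 2)))"
    by (subst summable_Suc_iff)
  then show "summable (\<lambda>k. real (Suc k) powr (- (1 + real d / 2)) / thermal_volume)"
    by (rule summable_divide)
next
  fix k :: nat
  have "exp (\<beta> * real (Suc k) * \<gamma>) \<le> 1"
    using assms beta_pos by (simp add: mult_nonneg_nonpos)
  then have "q d \<beta> \<gamma> (Suc k) \<le> 1 / (thermal_volume * real (Suc k) powr (1 + real d / 2))"
    unfolding q_def thermal_volume_def[symmetric] using thermal_volume_pos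
    by (intro divide_right_mono) auto
  also have "\<dots> = real (Suc k) powr (- (1 + real d / 2)) / thermal_volume"
    by (subst powr_minus) (simp add: field_simps)
  finally show "norm (q d \<beta> \<gamma> (Suc k)) \<le> real (Suc k) powr (- (1 + real d / 2)) / thermal_volume"
    using q_pos[of \<gamma> k] by simp
qed

lemma qbar_sums: "\<gamma> \<le> 0 \<Longrightarrow> (\<lambda>k. q d \<beta> \<gamma> (Suc k)) sums qbar d \<beta> \<gamma>"
  unfolding qbar_def by (intro summable_sums q_summable)

text \<open>
  For \<open>\<gamma> < 0\<close> the weights decay geometrically, so the density is finite in every dimension; at
  \<open>\<gamma> = 0\<close> this needs \<open>d \<ge> 3\<close>.
\<close>

lemma q_summable_weighted:
  assumes "\<gamma> < 0"
  shows "summable (\<lambda>k. real (Suc k) * q d \<beta> \<gamma> (Suc k))"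
proof (rule summable_comparison_test'[where N=0])
  define z where "z = exp (\<beta> * \<gamma>)"
  have z: "0 < z" "z < 1" using assms beta_pos by (auto simp: z_def mult_pos_neg)
  then have "summable (\<lambda>k. z ^ Suc k)" by (simp add: summable_geometric summable_mult)
  then show "summable (\<lambda>k. z ^ Suc k / thermal_volume)" by (rule summable_divide)
  fix k :: nat
  have "real (Suc k) * q d \<beta> \<gamma> (Suc k) =
        z ^ Suc k / thermal_volume * (real (Suc k) / real (Suc k) powr (1 + real d / 2))"
    by (simp only: q_def z_def thermal_volume_def exp_of_nat_mult[symmetric]) (simp add: mult_ac)
  also have "\<dots> \<le> z ^ Suc k / thermal_volume * 1"
  proof (intro mult_left_mono)
    have "real (Suc k) powr 1 \<le> real (Suc k) powr (1 + real d / 2)"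
      by (intro powr_mono) auto
    then show "real (Suc k) / real (Suc k) powr (1 + real d / 2) \<le> 1"
      by (subst divide_le_eq_1_pos) simp_all
  qed (use z thermal_volume_pos in auto)
  finally show "norm (real (Suc k) * q d \<beta> \<gamma> (Suc k)) \<le> z ^ Suc k / thermal_volume"
    using q_pos[of \<gamma> k] by simp
qed

lemma varrho_finite_iff:
  "varrho d \<beta> \<gamma> = ereal s \<longleftrightarrow> (\<lambda>k. real (Suc k) * q d \<beta> \<gamma> (Suc k)) sums s"
  unfolding varrho_eq_D using q_pos by (intro D_finite_iff) (simp add: less_imp_le)

lemma varrho_neg_finite:
  assumes "\<gamma> < 0"
  obtains s where "varrho d \<beta> \<gamma> = ereal s"
  using varrho_finite_iff[THEN iffD2, OF summable_sums[OF q_summable_weighted[OF assms]]] by (rule that)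

lemma varrho_pos: "0 < varrho d \<beta> \<gamma>"
proof -
  have "ereal (real (Suc 0) * q d \<beta> \<gamma> (Suc 0)) \<le> varrho d \<beta> \<gamma>"
    unfolding varrho_def
    using sum_le_suminf[OF summable_ereal_pos, of "\<lambda>k. ereal (real (Suc k) * q d \<beta> \<gamma> (Suc k))" "{0}"]
    using q_pos by (simp add: less_imp_le)
  moreover have "0 < ereal (real (Suc 0) * q d \<beta> \<gamma> (Suc 0))" using q_pos[of \<gamma> 0] by simp
  ultimately show ?thesis by order
qed

lemma varrho_mono:
  assumes "\<gamma> \<le> \<gamma>'"
  shows "varrho d \<beta> \<gamma> \<le> varrho d \<beta> \<gamma>'"
  unfolding varrho_def
proof (intro suminf_le summable_ereal_pos)
  fix k
  show "ereal (real (Suc k) * q d \<beta> \<gamma> (Suc k)) \<le> ereal (real (Suc k) * q d \<beta> \<gamma>' (Suc k))"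
    using q_mono[OF assms, of "Suc k"] by simp
qed (use q_pos in \<open>simp_all add: less_imp_le\<close>)

lemma varrho_strict_mono:
  assumes "\<gamma> < \<gamma>'" "\<gamma>' \<le> 0"
  shows "varrho d \<beta> \<gamma> < varrho d \<beta> \<gamma>'"
proof -
  have "\<gamma> < 0" using assms by simp
  then obtain s where s: "varrho d \<beta> \<gamma> = ereal s" by (rule varrho_neg_finite)
  show ?thesis
  proof (cases "varrho d \<beta> \<gamma>'")
    case (real s')
    have "(\<lambda>k. real (Suc k) * q d \<beta> \<gamma>' (Suc k) - real (Suc k) * q d \<beta> \<gamma> (Suc k)) sums (s' - s)"
      using s real by (intro sums_diff) (simp_all only: varrho_finite_iff)
    then have "0 < s' - s"
      using suminf_pos[of "\<lambda>k. real (Suc k) * q d \<beta> \<gamma>' (Suc k) - real (Suc k) * q d \<beta> \<gamma> (Suc k)"]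
        q_strict_mono[OF assms(1)] by (simp add: sums_iff)
    then show ?thesis using s real by simp
  qed (use s varrho_pos[of \<gamma>'] in auto)
qed

text \<open>
  Distributing the constant \<open>qbar / \<beta>\<close> over the terms turns the rate function into a series of
  relative entropies, hence of nonnegative terms.
\<close>

lemma I_rate_sums:
  assumes \<gamma>: "\<gamma> \<le> 0" and x: "x \<in> l1_plus"
  shows "(\<lambda>k. ereal (rel_ent (x (Suc k)) (q d \<beta> \<gamma> (Suc k)) / \<beta>)) sums I_rate d \<beta> \<gamma> x"
proof -
  let ?r = "\<lambda>k. rel_ent (x (Suc k)) (q d \<beta> \<gamma> (Suc k)) / \<beta>"
  let ?t = "\<lambda>k. x (Suc k) / \<beta> * (ln (x (Suc k) / q d \<beta> \<gamma> (Suc k)) - 1)"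
  have r_nonneg: "0 \<le> ?r k" for k
    using x q_pos[of \<gamma> k] beta_pos by (simp add: rel_ent_nonneg l1_plus_def)
  have S: "(\<lambda>k. ereal (?r k)) sums (\<Sum>k. ereal (?r k))"
    by (intro summable_sums summable_ereal_pos) (use r_nonneg in simp)
  have Q: "(\<lambda>k. ereal (- q d \<beta> \<gamma> (Suc k) / \<beta>)) sums ereal (- qbar d \<beta> \<gamma> / \<beta>)"
    unfolding sums_ereal by (intro sums_divide sums_minus qbar_sums \<gamma>)
  have split: "?r k + (- q d \<beta> \<gamma> (Suc k) / \<beta>) = ?t k" for k
    by (simp only: rel_ent_def) (simp add: algebra_simps add_divide_distrib diff_divide_distrib)
  have "(\<lambda>n. (\<Sum>k<n. ereal (?r k)) + (\<Sum>k<n. ereal (- q d \<beta> \<gamma> (Suc k) / \<beta>)))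
      \<longlonglongrightarrow> (\<Sum>k. ereal (?r k)) + ereal (- qbar d \<beta> \<gamma> / \<beta>)"
    using S Q unfolding sums_def by (intro tendsto_add_ereal_general1) simp_all
  moreover have "(\<Sum>k<n. ereal (?r k)) + (\<Sum>k<n. ereal (- q d \<beta> \<gamma> (Suc k) / \<beta>))
      = (\<Sum>k<n. ereal (?t k))" for n
    by (simp only: sum.distrib[symmetric] plus_ereal.simps split)
  ultimately have "(\<lambda>k. ereal (?t k)) sums ((\<Sum>k. ereal (?r k)) + ereal (- qbar d \<beta> \<gamma> / \<beta>))"
    by (simp only: sums_def)
  then have "(\<Sum>k. ereal (?t k)) = (\<Sum>k. ereal (?r k)) + ereal (- qbar d \<beta> \<gamma> / \<beta>)"
    by (rule sums_unique[symmetric])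
  then have "I_rate d \<beta> \<gamma> x = (\<Sum>k. ereal (?r k))"
    unfolding I_rate_def by (cases "\<Sum>k. ereal (?r k)") simp_all
  then show ?thesis using S by simp
qed

lemma I_rate_nonneg:
  assumes "\<gamma> \<le> 0" "x \<in> l1_plus"
  shows "0 \<le> I_rate d \<beta> \<gamma> x"
proof -
  have "0 \<le> rel_ent (x (Suc k)) (q d \<beta> \<gamma> (Suc k)) / \<beta>" for k
    using assms(2) q_pos[of \<gamma> k] beta_pos by (simp add: rel_ent_nonneg l1_plus_def)
  then show ?thesis by (intro sums_le[OF _ sums_zero I_rate_sums[OF assms]]) simp
qed

lemma I_rate_eq_0_iff:
  assumes "\<gamma> \<le> 0" and x: "x \<in> l1_plus"
  shows "I_rate d \<beta> \<gamma> x = 0 \<longleftrightarrow> (\<forall>k. x (Suc k) = q d \<beta> \<gamma> (Suc k))"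
proof -
  let ?r = "\<lambda>k. rel_ent (x (Suc k)) (q d \<beta> \<gamma> (Suc k)) / \<beta>"
  have x_nonneg: "0 \<le> x k" for k using x by (simp add: l1_plus_def)
  have r_nonneg: "0 \<le> ?r k" for k
    using x_nonneg q_pos[of \<gamma> k] beta_pos by (simp add: rel_ent_nonneg)
  have "I_rate d \<beta> \<gamma> x = 0 \<longleftrightarrow> (\<forall>k. ?r k = 0)"
  proof
    assume "I_rate d \<beta> \<gamma> x = 0"
    then have "?r sums 0" using I_rate_sums[OF assms] by (simp add: zero_ereal_def sums_ereal)
    then show "\<forall>k. ?r k = 0"
      using suminf_eq_zero_iff[of ?r] r_nonneg by (auto simp: sums_iff)
  next
    assume "\<forall>k. ?r k = 0"
    then have "(\<lambda>k. ereal (?r k)) = (\<lambda>k. 0)" by (simp only: zero_ereal_def)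
    then show "I_rate d \<beta> \<gamma> x = 0"
      using I_rate_sums[OF assms] sums_unique2[OF _ sums_zero] by simp
  qed
  then show ?thesis
    using rel_ent_eq_0_iff[OF x_nonneg q_pos] beta_pos by simp
qed

lemma p_ideal_diff_sums:
  assumes "\<gamma> \<le> 0" "\<gamma>' \<le> 0"
  shows "(\<lambda>k. (q d \<beta> \<gamma>' (Suc k) - q d \<beta> \<gamma> (Suc k)) / \<beta>) sums (p_ideal d \<beta> \<gamma>' - p_ideal d \<beta> \<gamma>)"
  unfolding p_ideal_def diff_divide_distrib[symmetric]
  by (intro sums_divide sums_diff qbar_sums assms)

text \<open>
  Summing the tilting identity over the cycle lengths: up to a constant, which is a difference of ideal
  pressures, the rate functions at two chemical potentials differ by a multiple of the density.
\<close>

lemma I_rate_tilt: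
  assumes \<alpha>: "\<alpha> \<le> 0" and \<theta>: "\<alpha> + \<theta> \<le> 0" and x: "x \<in> l1_plus" and s: "D x = ereal s"
  shows "I_rate d \<beta> \<alpha> x = I_rate d \<beta> (\<alpha> + \<theta>) x + ereal (\<theta> * s - (p_ideal d \<beta> (\<alpha> + \<theta>) - p_ideal d \<beta> \<alpha>))"
proof -
  have x_nonneg: "0 \<le> x k" for k using x by (simp add: l1_plus_def)
  let ?l = "\<lambda>k. \<theta> * (real (Suc k) * x (Suc k)) - (q d \<beta> (\<alpha> + \<theta>) (Suc k) - q d \<beta> \<alpha> (Suc k)) / \<beta>"
  have L: "(\<lambda>k. ereal (?l k)) sums ereal (\<theta> * s - (p_ideal d \<beta> (\<alpha> + \<theta>) - p_ideal d \<beta> \<alpha>))"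
    unfolding sums_ereal
    by (intro sums_diff sums_mult p_ideal_diff_sums \<alpha> \<theta> D_finite_iff[THEN iffD1] s x_nonneg)
  have split: "rel_ent (x (Suc k)) (q d \<beta> (\<alpha> + \<theta>) (Suc k)) / \<beta> + ?l k
      = rel_ent (x (Suc k)) (q d \<beta> \<alpha> (Suc k)) / \<beta>" for k
  proof -
    have *: "(r + (\<beta> * n * \<theta> * y - e)) / \<beta> = r / \<beta> + (\<theta> * (n * y) - e / \<beta>)" for r n y e :: real
      using beta_pos by (simp add: field_simps)
    show ?thesis
      unfolding q_tilt[of d \<beta> \<alpha> \<theta> "Suc k"]
        rel_ent_tilt[OF x_nonneg[of "Suc k"] q_pos[of \<alpha> k], of "\<beta> * real (Suc k) * \<theta>"] *
      by (rule refl)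
  qed
  have "(\<lambda>n. (\<Sum>k<n. ereal (rel_ent (x (Suc k)) (q d \<beta> (\<alpha> + \<theta>) (Suc k)) / \<beta>)) + (\<Sum>k<n. ereal (?l k)))
      \<longlonglongrightarrow> I_rate d \<beta> (\<alpha> + \<theta>) x + ereal (\<theta> * s - (p_ideal d \<beta> (\<alpha> + \<theta>) - p_ideal d \<beta> \<alpha>))"
    using I_rate_sums[OF \<theta> x] L unfolding sums_def by (intro tendsto_add_ereal_general1) simp_all
  then have "(\<lambda>k. ereal (rel_ent (x (Suc k)) (q d \<beta> \<alpha> (Suc k)) / \<beta>)) sums
      (I_rate d \<beta> (\<alpha> + \<theta>) x + ereal (\<theta> * s - (p_ideal d \<beta> (\<alpha> + \<theta>) - p_ideal d \<beta> \<alpha>)))"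
    by (simp only: sums_def sum.distrib[symmetric] plus_ereal.simps split)
  then show ?thesis using I_rate_sums[OF \<alpha> x] sums_unique2 by blast
qed

section \<open>The self-consistency equation\<close>

lemma varrho_sums:
  assumes "\<gamma> < 0"
  shows "varrho d \<beta> \<gamma> = ereal (\<Sum>k. real (Suc k) * q d \<beta> \<gamma> (Suc k))"
  using summable_sums[OF q_summable_weighted[OF assms]] by (rule varrho_finite_iff[THEN iffD2])

lemma varrho_continuous:
  assumes "\<alpha> \<le> 0" "u < 0"
  shows "continuous_on {l..u} (\<lambda>\<theta>. \<Sum>k. real (Suc k) * q d \<beta> (\<alpha> + \<theta>) (Suc k))"
proof (rule uniform_limit_theorem)
  show "uniform_limit {l..u} (\<lambda>n \<theta>. \<Sum>k<n. real (Suc k) * q d \<beta> (\<alpha> + \<theta>) (Suc k))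
      (\<lambda>\<theta>. \<Sum>k. real (Suc k) * q d \<beta> (\<alpha> + \<theta>) (Suc k)) sequentially"
  proof (rule Weierstrass_m_test)
    show "summable (\<lambda>k. real (Suc k) * q d \<beta> (\<alpha> + u) (Suc k))"
      using assms by (intro q_summable_weighted) simp
    fix n \<theta> assume "\<theta> \<in> {l..u}"
    then have "q d \<beta> (\<alpha> + \<theta>) (Suc n) \<le> q d \<beta> (\<alpha> + u) (Suc n)" by (intro q_mono) simp
    then show "norm (real (Suc n) * q d \<beta> (\<alpha> + \<theta>) (Suc n)) \<le> real (Suc n) * q d \<beta> (\<alpha> + u) (Suc n)"
      using q_pos[of "\<alpha> + \<theta>" n] by simp
  qed
  show "\<forall>\<^sub>F n in sequentially. continuous_on {l..u}
      (\<lambda>\<theta>. \<Sum>k<n. real (Suc k) * q d \<beta> (\<alpha> + \<theta>) (Suc k))"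
    unfolding q_tilt by (intro always_eventually allI continuous_intros)
qed simp

text \<open>
  The density is a supremum of finite sums, each of them continuous in \<open>\<theta>\<close>. So it cannot jump
  down when \<open>\<theta>\<close> leaves \<open>0\<close> to the left, even where it is infinite.
\<close>

lemma varrho_lower_semicontinuous:
  assumes "ereal c < varrho d \<beta> \<alpha>"
  obtains \<theta>0 where "\<theta>0 < 0" "\<And>\<theta>. \<theta>0 \<le> \<theta> \<Longrightarrow> \<theta> < 0 \<Longrightarrow> ereal c < varrho d \<beta> (\<alpha> + \<theta>)"
proof -
  let ?f = "\<lambda>\<theta> k. real (Suc k) * q d \<beta> (\<alpha> + \<theta>) (Suc k)"
  have nonneg: "0 \<le> ereal (?f \<theta> k)" for \<theta> k using q_pos[of "\<alpha> + \<theta>" k] by simp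
  have SUP: "varrho d \<beta> (\<alpha> + \<theta>) = (SUP n. \<Sum>k<n. ereal (?f \<theta> k))" for \<theta>
    unfolding varrho_def by (rule suminf_ereal_eq_SUP) (rule nonneg)
  from assms SUP[of 0] obtain n where n: "ereal c < (\<Sum>k<n. ereal (?f 0 k))"
    by (auto simp: less_SUP_iff)
  have "isCont (\<lambda>\<theta>. \<Sum>k<n. ?f \<theta> k) 0"
    unfolding q_tilt by (intro continuous_intros)
  then have "((\<lambda>\<theta>. \<Sum>k<n. ?f \<theta> k) \<longlongrightarrow> (\<Sum>k<n. ?f 0 k)) (at 0)" by (simp only: isCont_def)
  then have "\<forall>\<^sub>F \<theta> in at 0. c < (\<Sum>k<n. ?f \<theta> k)"
    by (rule order_tendstoD) (use n in simp)
  then have "\<forall>\<^sub>F \<theta> in at_left 0. c < (\<Sum>k<n. ?f \<theta> k)"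
    using eventually_at_split by blast
  then obtain b where b: "b < 0" "\<And>\<theta>. b < \<theta> \<Longrightarrow> \<theta> < 0 \<Longrightarrow> c < (\<Sum>k<n. ?f \<theta> k)"
    unfolding eventually_at_left_field by blast
  show thesis
  proof (rule that)
    show "b / 2 < 0" using b by simp
    fix \<theta> :: real assume "b / 2 \<le> \<theta>" "\<theta> < 0"
    then have "c < (\<Sum>k<n. ?f \<theta> k)" using b by (intro b(2)) simp_all
    then have "ereal c < (\<Sum>k<n. ereal (?f \<theta> k))" by simp
    also have "\<dots> \<le> varrho d \<beta> (\<alpha> + \<theta>)" unfolding SUP by (rule SUP_upper) simp
    finally show "ereal c < varrho d \<beta> (\<alpha> + \<theta>)" .
  qed
qed

text \<open>
  The equation says that the ideal gas, at the chemical potential reduced by the mean field of a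
  density \<open>\<delta>\<close>, has density \<open>\<delta>\<close>.
\<close>

lemma delta_eq_iff_varrho:
  "delta_eq d \<beta> \<alpha> \<mu> a \<delta> \<longleftrightarrow> varrho d \<beta> (\<alpha> + min (\<mu> - a * \<delta>) 0) = ereal \<delta>"
  unfolding delta_eq_def varrho_def q_tilt by (auto simp: mult.assoc)

text \<open>
  The left-hand side of the equation grows with \<open>\<delta>\<close>, and the right-hand side does not.
\<close>

lemma delta_eq_unique:
  assumes a: "0 \<le> a" and "delta_eq d \<beta> \<alpha> \<mu> a \<delta>" "delta_eq d \<beta> \<alpha> \<mu> a \<delta>'"
  shows "\<delta> = \<delta>'"
proof -
  have le: "y \<le> x" if "x \<le> y" "delta_eq d \<beta> \<alpha> \<mu> a x" "delta_eq d \<beta> \<alpha> \<mu> a y" for x y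
  proof -
    have "a * x \<le> a * y" using a that by (intro mult_left_mono)
    then have "varrho d \<beta> (\<alpha> + min (\<mu> - a * y) 0) \<le> varrho d \<beta> (\<alpha> + min (\<mu> - a * x) 0)"
      by (intro varrho_mono) simp
    then show ?thesis using that by (simp add: delta_eq_iff_varrho)
  qed
  show ?thesis using le[of \<delta> \<delta>'] le[of \<delta>' \<delta>] assms by linarith
qed

lemma delta_star_eqI:
  assumes "0 \<le> a" "delta_eq d \<beta> \<alpha> \<mu> a \<delta>"
  shows "delta_star d \<beta> \<alpha> \<mu> a = \<delta>"
  unfolding delta_star_def using assms delta_eq_unique by (intro the_equality) auto

lemma delta_eq_saturated:
  assumes "varrho d \<beta> \<alpha> = ereal r" "a * r \<le> \<mu>"
  shows "delta_eq d \<beta> \<alpha> \<mu> a r"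
  using assms by (simp add: delta_eq_iff_varrho min_def)

text \<open>
  In terms of the tilt \<open>\<theta> = \<mu> - a * \<delta> < 0\<close> the equation is \<open>varrho (\<alpha> + \<theta>) = (\<mu> - \<theta>) / a\<close>. The
  difference of its two sides is continuous, negative for very negative \<open>\<theta>\<close>, and positive near
  \<open>0\<close> because the density at \<open>\<alpha>\<close> itself exceeds \<open>\<mu> / a\<close>.
\<close>

lemma delta_eq_exists_unsaturated:
  assumes \<alpha>: "\<alpha> \<le> 0" and a: "0 < a" and less: "ereal \<mu> < ereal a * varrho d \<beta> \<alpha>"
  obtains \<delta> where "delta_eq d \<beta> \<alpha> \<mu> a \<delta>" "\<mu> < a * \<delta>"
proof -
  let ?R = "\<lambda>\<theta>. \<Sum>k. real (Suc k) * q d \<beta> (\<alpha> + \<theta>) (Suc k)"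
  have R: "varrho d \<beta> (\<alpha> + \<theta>) = ereal (?R \<theta>)" if "\<theta> < 0" for \<theta>
    using \<alpha> that by (intro varrho_sums) simp
  let ?T = "\<lambda>\<theta>. ?R \<theta> - (\<mu> - \<theta>) / a"
  have "ereal (\<mu> / a) < varrho d \<beta> \<alpha>"
    using less a by (cases "varrho d \<beta> \<alpha>") (auto simp: field_simps)
  then obtain c where c: "ereal (\<mu> / a) < ereal c" "ereal c < varrho d \<beta> \<alpha>"
    using ereal_dense2 by blast
  obtain \<theta>0 where \<theta>0: "\<theta>0 < 0" "\<And>\<theta>. \<theta>0 \<le> \<theta> \<Longrightarrow> \<theta> < 0 \<Longrightarrow> ereal c < varrho d \<beta> (\<alpha> + \<theta>)"
    using varrho_lower_semicontinuous[OF c(2)] by blast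
  \<comment> \<open>At \<open>\<theta> = \<mu> - a * c\<close> the line \<open>(\<mu> - \<theta>) / a\<close> has the value \<open>c\<close>, and it is decreasing.\<close>
  define u where "u = max \<theta>0 (\<mu> - a * c)"
  have u: "u < 0" using \<theta>0(1) c(1) a by (simp add: u_def field_simps)
  have "(\<mu> - u) / a \<le> c" using a by (simp add: u_def field_simps)
  moreover have "c < ?R u" using \<theta>0(2)[of u] u R by (simp add: u_def)
  ultimately have Tu: "0 \<le> ?T u" by simp
  \<comment> \<open>The density on the left of \<open>u\<close> is at most \<open>?R u\<close>, and the line exceeds this value at \<open>l\<close>.\<close>
  define l where "l = min u (\<mu> - a * ?R u)"
  have "?R l \<le> ?R u"
    using varrho_mono[of "\<alpha> + l" "\<alpha> + u"] R[of l] R[of u] u by (simp add: l_def)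
  also have "?R u \<le> (\<mu> - l) / a" using a by (simp add: l_def field_simps min_def)
  finally have Tl: "?T l \<le> 0" by simp
  have "continuous_on {l..u} ?T"
    using a by (intro continuous_on_diff varrho_continuous[OF \<alpha> u] continuous_intros) simp
  then obtain \<theta> where \<theta>: "l \<le> \<theta>" "\<theta> \<le> u" "?T \<theta> = 0"
    using IVT'[of ?T l 0 u] Tl Tu by (auto simp: l_def)
  define \<delta> where "\<delta> = (\<mu> - \<theta>) / a"
  have eq: "\<mu> - a * \<delta> = \<theta>" using a by (simp add: \<delta>_def)
  show thesis
  proof (rule that)
    show "delta_eq d \<beta> \<alpha> \<mu> a \<delta>"
      unfolding delta_eq_iff_varrho eq using \<theta> u R[of \<theta>] by (simp add: \<delta>_def min_def)
    show "\<mu> < a * \<delta>" using eq \<theta> u by simp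
  qed
qed

lemma saturatedE:
  assumes "0 < a" "ereal a * varrho d \<beta> \<alpha> \<le> ereal \<mu>"
  obtains r where "varrho d \<beta> \<alpha> = ereal r" "a * r \<le> \<mu>"
  using assms varrho_pos[of \<alpha>] by (cases "varrho d \<beta> \<alpha>") auto

lemma delta_star_saturated:
  assumes "0 \<le> a" "varrho d \<beta> \<alpha> = ereal r" "a * r \<le> \<mu>"
  shows "delta_eq d \<beta> \<alpha> \<mu> a (delta_star d \<beta> \<alpha> \<mu> a)" "delta_star d \<beta> \<alpha> \<mu> a = r"
  using delta_eq_saturated[OF assms(2,3)] delta_star_eqI[OF assms(1)] by auto

lemma delta_star_unsaturated:
  assumes \<alpha>: "\<alpha> \<le> 0" and a: "0 \<le> a" and less: "ereal \<mu> < ereal a * varrho d \<beta> \<alpha>"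
  defines "\<delta> \<equiv> delta_star d \<beta> \<alpha> \<mu> a"
  shows "delta_eq d \<beta> \<alpha> \<mu> a \<delta>" "\<mu> < a * \<delta>" "0 < \<delta>" "varrho d \<beta> (\<alpha> + \<mu> - a * \<delta>) = ereal \<delta>"
    "ereal \<delta> < varrho d \<beta> \<alpha>"
proof -
  have "\<exists>\<delta>. delta_eq d \<beta> \<alpha> \<mu> a \<delta> \<and> \<mu> < a * \<delta>"
  proof (cases "a = 0")
    case True
    then have \<mu>: "\<mu> < 0" using less by (simp add: zero_ereal_def[symmetric])
    then obtain s where "varrho d \<beta> (\<alpha> + \<mu>) = ereal s"
      using varrho_neg_finite[of "\<alpha> + \<mu>"] \<alpha> by auto
    then have "delta_eq d \<beta> \<alpha> \<mu> a s" using True \<mu> by (simp add: delta_eq_iff_varrho)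
    then show ?thesis using True \<mu> by auto
  next
    case False
    then show ?thesis using delta_eq_exists_unsaturated[OF \<alpha> _ less] a by (metis less_eq_real_def)
  qed
  then show eq: "delta_eq d \<beta> \<alpha> \<mu> a \<delta>" and less: "\<mu> < a * \<delta>"
    unfolding \<delta>_def using delta_star_eqI[OF a] by auto
  then show v: "varrho d \<beta> (\<alpha> + \<mu> - a * \<delta>) = ereal \<delta>"
    by (simp add: delta_eq_iff_varrho add_diff_eq)
  show "0 < \<delta>" using varrho_pos[of "\<alpha> + \<mu> - a * \<delta>"] v by simp
  show "ereal \<delta> < varrho d \<beta> \<alpha>"
    using varrho_strict_mono[of "\<alpha> + \<mu> - a * \<delta>" \<alpha>] less \<alpha> v by simp
qed

section \<open>Duality\<close>

text \<open>
  The cycle densities of the ideal gas, that is, the minimiser of the rate function; the value at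
  \<open>0\<close> is the one required in \<^const>\<open>l1_plus\<close>.
\<close>

definition bose_profile :: "real \<Rightarrow> nat \<Rightarrow> real" where
  "bose_profile \<gamma> k = (if k = 0 then 0 else q d \<beta> \<gamma> k)"

text \<open>
  The dual function of the mean-field problem: the quadratic energy is replaced by its tangent at
  the density \<open>m\<close>, which leaves an ideal gas with chemical potential shifted by \<open>\<mu> - a * m\<close>.
\<close>

definition mf_dual :: "real \<Rightarrow> real \<Rightarrow> real \<Rightarrow> real \<Rightarrow> real" where
  "mf_dual \<alpha> \<mu> a m = a / 2 * m\<^sup>2 + p_ideal d \<beta> (\<alpha> + (\<mu> - a * m)) - p_ideal d \<beta> \<alpha>"

lemma bose_profile_l1: "\<gamma> \<le> 0 \<Longrightarrow> bose_profile \<gamma> \<in> l1_plus"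
proof -
  assume "\<gamma> \<le> 0"
  then have "summable (\<lambda>k. bose_profile \<gamma> (Suc k))"
    using q_summable by (simp add: bose_profile_def)
  then have "summable (bose_profile \<gamma>)" by (simp only: summable_Suc_iff)
  moreover have "0 \<le> bose_profile \<gamma> k" for k
    using q_pos[of \<gamma>] by (cases k) (simp_all add: bose_profile_def less_imp_le)
  ultimately show ?thesis by (simp add: l1_plus_def bose_profile_def)
qed

lemma D_bose_profile: "D (bose_profile \<gamma>) = varrho d \<beta> \<gamma>"
  by (simp add: D_def varrho_def bose_profile_def)

lemma l1_plus_eq_bose_profile_iff:
  "x \<in> l1_plus \<Longrightarrow> x = bose_profile \<gamma> \<longleftrightarrow> (\<forall>k. x (Suc k) = q d \<beta> \<gamma> (Suc k))"
  by (auto simp: fun_eq_iff bose_profile_def l1_plus_def gr0_conv_Suc)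

text \<open>
  A parabola lies above its tangent at \<open>m\<close>.
\<close>

lemma square_dual: "0 \<le> (a::real) \<Longrightarrow> - (\<mu> - a * m) * s - a / 2 * m\<^sup>2 \<le> - \<mu> * s + a / 2 * s\<^sup>2"
proof -
  assume "0 \<le> a"
  then have "0 \<le> a / 2 * (s - m)\<^sup>2" by simp
  then show ?thesis by (simp add: power2_eq_square algebra_simps)
qed

lemma H_PMF_lsc_real:
  assumes a: "0 < a" and s: "D x = ereal s"
  shows "H_PMF_lsc \<mu> a x = ereal (if \<mu> / a \<le> s then - \<mu> * s + a / 2 * s\<^sup>2 else - \<mu>\<^sup>2 / (2 * a))"
  using a by (simp add: H_PMF_lsc_def s power2_eq_square)

lemma H_PMF_lsc_zero:
  assumes \<mu>: "\<mu> \<le> 0" and s: "D x = ereal s" and "0 \<le> s"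
  shows "H_PMF_lsc \<mu> 0 x = ereal (- \<mu> * s)"
  using assms by (cases "\<mu> = 0") (auto simp: H_PMF_lsc_def s zero_ereal_def[symmetric] divide_ereal_def ereal_mult_infty)

text \<open>
  The flat piece of the regularised energy is the tangent at \<open>m = \<mu> / a\<close>. The tangents at larger
  \<open>m\<close> lie below the parabola and, being nondecreasing, also below the flat piece.
  At zero coupling the energy is its own tangent.
\<close>

lemma H_PMF_lsc_ge:
  assumes a: "0 < a \<or> a = 0 \<and> \<mu> \<le> 0" and m: "\<mu> \<le> a * m" and s: "D x = ereal s" "0 \<le> s"
  shows "ereal (- (\<mu> - a * m) * s - a / 2 * m\<^sup>2) \<le> H_PMF_lsc \<mu> a x"
proof (cases "a = 0")
  case False
  then have a: "0 < a" using a by simp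
  show ?thesis
  proof (cases "\<mu> / a \<le> s")
    case True
    then show ?thesis using square_dual[of a \<mu> m s] a by (simp add: H_PMF_lsc_real[OF a s(1)])
  next
    case False
    have "s \<le> \<mu> / a" using False by simp
    then have "(a * m - \<mu>) * s \<le> (a * m - \<mu>) * (\<mu> / a)" using m by (intro mult_left_mono) auto
    moreover have "(a * m - \<mu>) * (\<mu> / a) - a / 2 * m\<^sup>2 = - \<mu>\<^sup>2 / (2 * a) - (a * m - \<mu>)\<^sup>2 / (2 * a)"
      using a by (simp add: field_simps power2_eq_square)
    moreover have "0 \<le> (a * m - \<mu>)\<^sup>2 / (2 * a)" using a by simp
    ultimately show ?thesis using False by (simp add: H_PMF_lsc_real[OF a s(1)] algebra_simps)
  qed
next
  case True
  then show ?thesis using H_PMF_lsc_zero[OF _ s, of \<mu>] assms by simp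
qed

text \<open>
  The tangent of the energy is affine in the density, so tilting absorbs it: what is left of the
  rate function is again a rate function, at a shifted chemical potential. Being nonnegative with
  a single zero, it identifies both the minimum and the minimiser.
\<close>

lemma I_plus_H_ge:
  assumes \<alpha>: "\<alpha> \<le> 0" and a: "0 < a \<or> a = 0 \<and> \<mu> \<le> 0" and m: "\<mu> \<le> a * m" and x: "x \<in> l1_plus"
  shows "D x = \<infinity> \<and> I_rate d \<beta> \<alpha> x + H_PMF_lsc \<mu> a x = \<infinity>
    \<or> I_rate d \<beta> (\<alpha> + (\<mu> - a * m)) x - ereal (mf_dual \<alpha> \<mu> a m) \<le> I_rate d \<beta> \<alpha> x + H_PMF_lsc \<mu> a x"
proof (cases "D x")
  case PInf
  then show ?thesis using I_rate_nonneg[OF \<alpha> x] by (auto simp: H_PMF_lsc_def)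
next
  case (real s)
  have s: "0 \<le> s" using D_nonneg[OF x] real by simp
  have \<theta>: "\<alpha> + (\<mu> - a * m) \<le> 0" using \<alpha> m by simp
  have "I_rate d \<beta> (\<alpha> + (\<mu> - a * m)) x - ereal (mf_dual \<alpha> \<mu> a m)
      = I_rate d \<beta> \<alpha> x + ereal (- (\<mu> - a * m) * s - a / 2 * m\<^sup>2)"
    unfolding I_rate_tilt[OF \<alpha> \<theta> x real]
    by (cases "I_rate d \<beta> (\<alpha> + (\<mu> - a * m)) x") (simp_all add: mf_dual_def algebra_simps)
  also have "\<dots> \<le> I_rate d \<beta> \<alpha> x + H_PMF_lsc \<mu> a x"
    by (intro add_left_mono H_PMF_lsc_ge a m real s)
  finally show ?thesis by simp
next
  case MInf
  then show ?thesis using D_nonneg[OF x] by simp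
qed

lemma p_PMF_le_mf_dual:
  assumes \<alpha>: "\<alpha> \<le> 0" and a: "0 < a \<or> a = 0 \<and> \<mu> \<le> 0" and m: "\<mu> \<le> a * m"
  shows "p_PMF d \<beta> \<alpha> \<mu> a \<le> ereal (mf_dual \<alpha> \<mu> a m)"
proof -
  have "ereal (- mf_dual \<alpha> \<mu> a m) \<le> I_rate d \<beta> \<alpha> x + H_PMF_lsc \<mu> a x" if x: "x \<in> l1_plus" for x
  proof -
    have "0 \<le> I_rate d \<beta> (\<alpha> + (\<mu> - a * m)) x" using \<alpha> m x by (intro I_rate_nonneg) auto
    then have "ereal (- mf_dual \<alpha> \<mu> a m) \<le> I_rate d \<beta> (\<alpha> + (\<mu> - a * m)) x - ereal (mf_dual \<alpha> \<mu> a m)"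
      by (cases "I_rate d \<beta> (\<alpha> + (\<mu> - a * m)) x") auto
    then show ?thesis using I_plus_H_ge[OF \<alpha> a m x] by auto
  qed
  then have "ereal (- mf_dual \<alpha> \<mu> a m) \<le> (INF y\<in>l1_plus. I_rate d \<beta> \<alpha> y + H_PMF_lsc \<mu> a y)"
    by (rule INF_greatest)
  then show ?thesis unfolding p_PMF_def by (simp add: ereal_uminus_le_reorder)
qed

text \<open>
  The optimal contact point \<open>m\<close> of the tangent. Above saturation it exceeds the density
  \<open>delta_star\<close> of the minimiser; the difference is the condensate density. For \<open>a = 0\<close> the tilt
  \<open>\<mu> - a * m\<close> is \<open>\<mu>\<close> whatever \<open>m\<close> is, and the value of \<open>m\<close> is a convention.
\<close>

definition mf_density :: "real \<Rightarrow> real \<Rightarrow> real \<Rightarrow> real" where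
  "mf_density \<alpha> \<mu> a =
    (if a = 0 then delta_star d \<beta> \<alpha> \<mu> a else max (delta_star d \<beta> \<alpha> \<mu> a) (\<mu> / a))"

lemma mf_density_tilt:
  assumes a: "0 < a \<or> a = 0 \<and> \<mu> \<le> 0"
  shows "\<mu> - a * mf_density \<alpha> \<mu> a = min (\<mu> - a * delta_star d \<beta> \<alpha> \<mu> a) 0"
proof (cases "a = 0")
  case False
  then have "0 < a" using a by simp
  then show ?thesis by (auto simp: mf_density_def max_def min_def field_simps)
qed (use a in \<open>simp add: mf_density_def\<close>)

lemma xi_PMF_eq:
  assumes a: "0 < a \<or> a = 0 \<and> \<mu> \<le> 0"
  shows "xi_PMF d \<beta> \<alpha> \<mu> a = bose_profile (\<alpha> + (\<mu> - a * mf_density \<alpha> \<mu> a))"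
  unfolding mf_density_tilt[OF a] by (simp add: fun_eq_iff xi_PMF_def bose_profile_def q_tilt)

context
  fixes \<alpha> \<mu> a :: real
  assumes \<alpha>: "\<alpha> \<le> 0" and a: "0 < a \<or> a = 0 \<and> \<mu> \<le> 0"
    and \<delta>: "delta_eq d \<beta> \<alpha> \<mu> a (delta_star d \<beta> \<alpha> \<mu> a)"
begin

lemma tilt_nonpos: "\<mu> \<le> a * mf_density \<alpha> \<mu> a"
  using mf_density_tilt[OF a, of \<alpha>] by linarith

lemma xi_l1: "xi_PMF d \<beta> \<alpha> \<mu> a \<in> l1_plus"
  unfolding xi_PMF_eq[OF a] using tilt_nonpos \<alpha> by (intro bose_profile_l1) simp

lemma D_xi: "D (xi_PMF d \<beta> \<alpha> \<mu> a) = ereal (delta_star d \<beta> \<alpha> \<mu> a)"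
  unfolding xi_PMF_eq[OF a] D_bose_profile mf_density_tilt[OF a]
  using \<delta> by (simp add: delta_eq_iff_varrho)

text \<open>
  At the contact density the tangent touches the energy, and the profile is the zero of the tilted
  rate function, so every inequality of the duality argument is an equality.
\<close>

lemma I_plus_H_xi:
  "I_rate d \<beta> \<alpha> (xi_PMF d \<beta> \<alpha> \<mu> a) + H_PMF_lsc \<mu> a (xi_PMF d \<beta> \<alpha> \<mu> a)
     = ereal (- mf_dual \<alpha> \<mu> a (mf_density \<alpha> \<mu> a))"
proof -
  let ?\<delta> = "delta_star d \<beta> \<alpha> \<mu> a" and ?\<xi> = "xi_PMF d \<beta> \<alpha> \<mu> a"
  define m where "m = mf_density \<alpha> \<mu> a"
  have \<theta>: "\<alpha> + (\<mu> - a * m) \<le> 0" using tilt_nonpos \<alpha> by (simp add: m_def)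
  have "I_rate d \<beta> (\<alpha> + (\<mu> - a * m)) ?\<xi> = 0"
    using xi_l1 l1_plus_eq_bose_profile_iff xi_PMF_eq[OF a, of \<alpha>]
    by (subst I_rate_eq_0_iff[OF \<theta> xi_l1]) (auto simp: m_def)
  then have I: "I_rate d \<beta> \<alpha> ?\<xi>
      = ereal ((\<mu> - a * m) * ?\<delta> - (p_ideal d \<beta> (\<alpha> + (\<mu> - a * m)) - p_ideal d \<beta> \<alpha>))"
    using I_rate_tilt[OF \<alpha> \<theta> xi_l1 D_xi] by simp
  have "0 \<le> ?\<delta>" using D_nonneg[OF xi_l1] D_xi by simp
  have H: "H_PMF_lsc \<mu> a ?\<xi> = ereal (- (\<mu> - a * m) * ?\<delta> - a / 2 * m\<^sup>2)"
  proof (cases "a = 0")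
    case True
    then show ?thesis using H_PMF_lsc_zero[OF _ D_xi \<open>0 \<le> ?\<delta>\<close>] a by simp
  next
    case False
    then have a': "0 < a" using a by simp
    show ?thesis
    proof (cases "\<mu> / a \<le> ?\<delta>")
      case True
      then have "m = ?\<delta>" using False by (simp add: m_def mf_density_def)
      then show ?thesis using True a' by (simp add: H_PMF_lsc_real[OF a' D_xi] power2_eq_square algebra_simps)
    next
      case False
      then have "m = \<mu> / a" using a' by (simp add: m_def mf_density_def)
      then show ?thesis using False a'
        by (simp add: H_PMF_lsc_real[OF a' D_xi] power2_eq_square)
    qed
  qed
  show ?thesis unfolding I H m_def[symmetric] by (simp add: mf_dual_def algebra_simps)
qed

lemma p_PMF_eq_mf_dual: "p_PMF d \<beta> \<alpha> \<mu> a = ereal (mf_dual \<alpha> \<mu> a (mf_density \<alpha> \<mu> a))"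
proof (rule antisym)
  show "p_PMF d \<beta> \<alpha> \<mu> a \<le> ereal (mf_dual \<alpha> \<mu> a (mf_density \<alpha> \<mu> a))"
    by (rule p_PMF_le_mf_dual[OF \<alpha> a tilt_nonpos])
  have "(INF y\<in>l1_plus. I_rate d \<beta> \<alpha> y + H_PMF_lsc \<mu> a y) \<le> ereal (- mf_dual \<alpha> \<mu> a (mf_density \<alpha> \<mu> a))"
    using I_plus_H_xi by (intro INF_lower2[OF xi_l1]) simp
  then have "- ereal (- mf_dual \<alpha> \<mu> a (mf_density \<alpha> \<mu> a)) \<le> p_PMF d \<beta> \<alpha> \<mu> a"
    unfolding p_PMF_def by (simp only: ereal_minus_le_minus)
  then show "ereal (mf_dual \<alpha> \<mu> a (mf_density \<alpha> \<mu> a)) \<le> p_PMF d \<beta> \<alpha> \<mu> a" by simp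
qed

lemma I_PMF_eq_0_iff:
  assumes x: "x \<in> l1_plus"
  shows "I_PMF d \<beta> \<alpha> \<mu> a x = 0 \<longleftrightarrow> x = xi_PMF d \<beta> \<alpha> \<mu> a"
proof -
  let ?m = "mf_density \<alpha> \<mu> a" and ?F = "\<lambda>x. I_rate d \<beta> \<alpha> x + H_PMF_lsc \<mu> a x"
  have "(INF y\<in>l1_plus. ?F y) = ereal (- mf_dual \<alpha> \<mu> a ?m)"
    using p_PMF_eq_mf_dual unfolding p_PMF_def by (simp add: ereal_uminus_eq_reorder)
  then have eq: "I_PMF d \<beta> \<alpha> \<mu> a x = ?F x - ereal (- mf_dual \<alpha> \<mu> a ?m)"
    by (simp add: I_PMF_def)
  show ?thesis
  proof
    assume "I_PMF d \<beta> \<alpha> \<mu> a x = 0"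
    then have F: "?F x = ereal (- mf_dual \<alpha> \<mu> a ?m)"
      unfolding eq by (cases "?F x") (simp_all add: zero_ereal_def)
    have \<theta>: "\<alpha> + (\<mu> - a * ?m) \<le> 0" using tilt_nonpos \<alpha> by simp
    have "I_rate d \<beta> (\<alpha> + (\<mu> - a * ?m)) x - ereal (mf_dual \<alpha> \<mu> a ?m) \<le> ereal (- mf_dual \<alpha> \<mu> a ?m)"
      using I_plus_H_ge[OF \<alpha> a tilt_nonpos x] F by auto
    then have "I_rate d \<beta> (\<alpha> + (\<mu> - a * ?m)) x \<le> 0"
      by (cases "I_rate d \<beta> (\<alpha> + (\<mu> - a * ?m)) x") auto
    then have "I_rate d \<beta> (\<alpha> + (\<mu> - a * ?m)) x = 0"
      using I_rate_nonneg[OF \<theta> x] by simp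
    then show "x = xi_PMF d \<beta> \<alpha> \<mu> a"
      by (simp add: I_rate_eq_0_iff[OF \<theta> x] xi_PMF_eq[OF a] l1_plus_eq_bose_profile_iff[OF x])
  next
    assume "x = xi_PMF d \<beta> \<alpha> \<mu> a"
    then show "I_PMF d \<beta> \<alpha> \<mu> a x = 0" unfolding eq using I_plus_H_xi by (simp add: zero_ereal_def)
  qed
qed

end

section \<open>The pressure as a function of the chemical potential\<close>

lemma delta_star_delta_eq:
  assumes \<alpha>: "\<alpha> \<le> 0" and a: "0 < a"
  shows "delta_eq d \<beta> \<alpha> \<mu> a (delta_star d \<beta> \<alpha> \<mu> a)"
proof (cases "ereal \<mu> < ereal a * varrho d \<beta> \<alpha>")
  case True
  then show ?thesis using delta_star_unsaturated(1)[OF \<alpha>] a by simp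
next
  case False
  then have "ereal a * varrho d \<beta> \<alpha> \<le> ereal \<mu>" by simp
  with a obtain r where "varrho d \<beta> \<alpha> = ereal r" "a * r \<le> \<mu>" by (rule saturatedE)
  then show ?thesis using delta_star_saturated(1) a by simp
qed

context
  fixes \<alpha> a :: real
  assumes \<alpha>: "\<alpha> \<le> 0" and a: "0 < a"
begin

lemma p_PMF_real: "p_PMF d \<beta> \<alpha> \<mu> a = ereal (mf_dual \<alpha> \<mu> a (mf_density \<alpha> \<mu> a))"
  using p_PMF_eq_mf_dual[OF \<alpha> _ delta_star_delta_eq[OF \<alpha> a]] a by simp

text \<open>
  If the tilt \<open>\<mu> - a * m\<close> decreased when \<open>\<mu>\<close> grows, the density would decrease too, and then the
  tilt could not have decreased. The two monotonicity statements together bound the growth rate of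
  \<open>m\<close> by \<open>1 / a\<close>.
\<close>

lemma mf_density_mono:
  assumes "\<mu> \<le> \<mu>'"
  shows "mf_density \<alpha> \<mu> a \<le> mf_density \<alpha> \<mu>' a"
    and "\<mu> - a * mf_density \<alpha> \<mu> a \<le> \<mu>' - a * mf_density \<alpha> \<mu>' a"
proof -
  have tilt: "\<mu> - a * mf_density \<alpha> \<mu> a = min (\<mu> - a * delta_star d \<beta> \<alpha> \<mu> a) 0" for \<mu>
    using a by (intro mf_density_tilt) simp
  have eq: "varrho d \<beta> (\<alpha> + (\<mu> - a * mf_density \<alpha> \<mu> a)) = ereal (delta_star d \<beta> \<alpha> \<mu> a)" for \<mu>
    using delta_star_delta_eq[OF \<alpha> a] by (simp add: delta_eq_iff_varrho tilt)
  have m: "mf_density \<alpha> \<mu> a = max (delta_star d \<beta> \<alpha> \<mu> a) (\<mu> / a)" for \<mu>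
    using a by (simp add: mf_density_def)
  show tilt_mono: "\<mu> - a * mf_density \<alpha> \<mu> a \<le> \<mu>' - a * mf_density \<alpha> \<mu>' a"
  proof (rule ccontr)
    assume "\<not> ?thesis"
    then have less: "\<mu>' - a * mf_density \<alpha> \<mu>' a < \<mu> - a * mf_density \<alpha> \<mu> a" by simp
    then have "\<mu>' - a * delta_star d \<beta> \<alpha> \<mu>' a < 0" using tilt[of \<mu>] tilt[of \<mu>'] by linarith
    then have "mf_density \<alpha> \<mu>' a = delta_star d \<beta> \<alpha> \<mu>' a"
      using tilt[of \<mu>'] a by simp
    also have "\<dots> \<le> delta_star d \<beta> \<alpha> \<mu> a"
      using varrho_mono[of "\<alpha> + (\<mu>' - a * mf_density \<alpha> \<mu>' a)" "\<alpha> + (\<mu> - a * mf_density \<alpha> \<mu> a)"] less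
      by (simp add: eq)
    also have "\<dots> \<le> mf_density \<alpha> \<mu> a" by (simp add: m)
    finally have "a * mf_density \<alpha> \<mu>' a \<le> a * mf_density \<alpha> \<mu> a" using a by simp
    then show False using less assms by linarith
  qed
  have "delta_star d \<beta> \<alpha> \<mu> a \<le> delta_star d \<beta> \<alpha> \<mu>' a"
    using varrho_mono[of "\<alpha> + (\<mu> - a * mf_density \<alpha> \<mu> a)" "\<alpha> + (\<mu>' - a * mf_density \<alpha> \<mu>' a)"] tilt_mono
    by (simp add: eq)
  moreover have "\<mu> / a \<le> \<mu>' / a" using assms a by (simp add: divide_right_mono)
  ultimately show "mf_density \<alpha> \<mu> a \<le> mf_density \<alpha> \<mu>' a" unfolding m by linarith
qed

lemma mf_density_lipschitz: "\<bar>mf_density \<alpha> \<mu>' a - mf_density \<alpha> \<mu> a\<bar> \<le> \<bar>\<mu>' - \<mu>\<bar> / a"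
proof -
  have *: "\<bar>mf_density \<alpha> y a - mf_density \<alpha> x a\<bar> \<le> \<bar>y - x\<bar> / a" if "x \<le> y" for x y
    using mf_density_mono[OF that] that a by (simp add: field_simps)
  show ?thesis using *[of \<mu> \<mu>'] *[of \<mu>' \<mu>] by (cases "\<mu> \<le> \<mu>'") (auto simp: abs_minus_commute)
qed

lemma mf_density_continuous: "continuous_on UNIV (\<lambda>\<mu>. mf_density \<alpha> \<mu> a)"
proof (rule lipschitz_on_continuous_on)
  show "(1 / a)-lipschitz_on UNIV (\<lambda>\<mu>. mf_density \<alpha> \<mu> a)"
    using mf_density_lipschitz a by (intro lipschitz_onI) (simp_all add: dist_real_def abs_minus_commute)
qed

text \<open>
  The pressure is a minimum over tangents. Moving the contact point by \<open>(\<mu>' - \<mu>) / a\<close> keeps the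
  tilt, hence also the ideal pressure in the dual function, so only the quadratic term changes.
\<close>

lemma p_PMF_quadratic_upper:
  "real_of_ereal (p_PMF d \<beta> \<alpha> \<mu>' a) \<le> real_of_ereal (p_PMF d \<beta> \<alpha> \<mu> a)
     + mf_density \<alpha> \<mu> a * (\<mu>' - \<mu>) + (\<mu>' - \<mu>)\<^sup>2 / (2 * a)"
proof -
  let ?m = "mf_density \<alpha> \<mu> a"
  let ?m' = "?m + (\<mu>' - \<mu>) / a"
  have \<theta>: "\<mu>' - a * ?m' = \<mu> - a * ?m" using a by (simp add: field_simps)
  have "\<mu> - a * ?m \<le> 0" using mf_density_tilt[of a \<mu> \<alpha>] a by simp
  then have "p_PMF d \<beta> \<alpha> \<mu>' a \<le> ereal (mf_dual \<alpha> \<mu>' a ?m')"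
    using a \<theta> by (intro p_PMF_le_mf_dual[OF \<alpha>]) simp_all
  moreover have "mf_dual \<alpha> \<mu>' a ?m' = mf_dual \<alpha> \<mu> a ?m + ?m * (\<mu>' - \<mu>) + (\<mu>' - \<mu>)\<^sup>2 / (2 * a)"
    unfolding mf_dual_def \<theta> using a by (simp add: field_simps power2_eq_square)
  ultimately show ?thesis by (simp add: p_PMF_real)
qed

text \<open>
  The quadratic upper bound, used in both directions, encloses the increment of the pressure
  between two quadratics whose slopes \<open>m\<close> at the two endpoints differ by at most
  \<open>\<bar>\<mu>' - \<mu>\<bar> / a\<close>.
\<close>

lemma p_PMF_has_derivative:
  "((\<lambda>\<mu>. real_of_ereal (p_PMF d \<beta> \<alpha> \<mu> a)) has_real_derivative mf_density \<alpha> \<mu> a) (at \<mu>)"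
proof -
  let ?f = "\<lambda>\<mu>. real_of_ereal (p_PMF d \<beta> \<alpha> \<mu> a)" and ?m = "\<lambda>\<mu>. mf_density \<alpha> \<mu> a"
  have bound: "\<bar>?f y - ?f \<mu> - ?m \<mu> * (y - \<mu>)\<bar> \<le> 2 / a * (y - \<mu>)\<^sup>2" for y
  proof -
    have sq: "0 \<le> (y - \<mu>)\<^sup>2 / a" using a by simp
    have "\<bar>(?m y - ?m \<mu>) * (y - \<mu>)\<bar> \<le> \<bar>y - \<mu>\<bar> / a * \<bar>y - \<mu>\<bar>"
      unfolding abs_mult by (intro mult_right_mono mf_density_lipschitz) simp
    also have "\<dots> = (y - \<mu>)\<^sup>2 / a" by (simp add: power2_eq_square)
    finally have "- ((y - \<mu>)\<^sup>2 / a) \<le> (?m y - ?m \<mu>) * (y - \<mu>)" by linarith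
    moreover have "?f \<mu> \<le> ?f y + ?m y * (\<mu> - y) + (y - \<mu>)\<^sup>2 / a / 2"
      using p_PMF_quadratic_upper[of \<mu> y] by (simp add: power2_commute field_simps)
    moreover have "?f y \<le> ?f \<mu> + ?m \<mu> * (y - \<mu>) + (y - \<mu>)\<^sup>2 / a / 2"
      using p_PMF_quadratic_upper[of y \<mu>] by (simp add: field_simps)
    moreover have "2 / a * (y - \<mu>)\<^sup>2 = 2 * ((y - \<mu>)\<^sup>2 / a)" by simp
    ultimately show ?thesis using sq by (simp add: algebra_simps abs_le_iff)
  qed
  have "((\<lambda>y. (?f y - ?f \<mu>) / (y - \<mu>) - ?m \<mu>) \<longlongrightarrow> 0) (at \<mu>)"
  proof (rule Lim_null_comparison)
    show "\<forall>\<^sub>F y in at \<mu>. norm ((?f y - ?f \<mu>) / (y - \<mu>) - ?m \<mu>) \<le> 2 / a * \<bar>y - \<mu>\<bar>"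
      unfolding eventually_at_filter
    proof (intro always_eventually allI impI)
      fix y assume "y \<noteq> \<mu>"
      then have y: "0 < \<bar>y - \<mu>\<bar>" by simp
      have "(?f y - ?f \<mu>) / (y - \<mu>) - ?m \<mu> = (?f y - ?f \<mu> - ?m \<mu> * (y - \<mu>)) / (y - \<mu>)"
        using y by (simp add: field_simps)
      then have "norm ((?f y - ?f \<mu>) / (y - \<mu>) - ?m \<mu>) = \<bar>?f y - ?f \<mu> - ?m \<mu> * (y - \<mu>)\<bar> / \<bar>y - \<mu>\<bar>"
        by (simp add: abs_divide)
      also have "\<dots> \<le> (2 / a * (y - \<mu>)\<^sup>2) / \<bar>y - \<mu>\<bar>"
        by (intro divide_right_mono bound) simp
      also have "\<dots> = 2 / a * \<bar>y - \<mu>\<bar>"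
      proof -
        have "(y - \<mu>)\<^sup>2 = \<bar>y - \<mu>\<bar> * \<bar>y - \<mu>\<bar>" by (simp add: power2_eq_square)
        then show ?thesis using y by (simp del: abs_mult_self_eq)
      qed
      finally show "norm ((?f y - ?f \<mu>) / (y - \<mu>) - ?m \<mu>) \<le> 2 / a * \<bar>y - \<mu>\<bar>" .
    qed
    show "((\<lambda>y. 2 / a * \<bar>y - \<mu>\<bar>) \<longlongrightarrow> 0) (at \<mu>)"
      by (rule tendsto_eq_intros refl | simp)+
  qed
  then have "((\<lambda>y. (?f y - ?f \<mu>) / (y - \<mu>)) \<longlongrightarrow> ?m \<mu>) (at \<mu>)" by (rule LIM_zero_cancel)
  then show ?thesis unfolding has_field_derivative_iff .
qed

lemma p_PMF_C1: "(\<lambda>\<mu>. real_of_ereal (p_PMF d \<beta> \<alpha> \<mu> a)) C1_differentiable_on UNIV"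
  unfolding C1_differentiable_on_def
  using p_PMF_has_derivative mf_density_continuous
  by (intro exI[of _ "\<lambda>\<mu>. mf_density \<alpha> \<mu> a"])
    (simp add: has_real_derivative_iff_has_vector_derivative)

lemma p_PMF_convex: "convex_on UNIV (\<lambda>\<mu>. real_of_ereal (p_PMF d \<beta> \<alpha> \<mu> a))"
  by (rule convex_on_realI[where f' = "\<lambda>\<mu>. mf_density \<alpha> \<mu> a"])
    (simp_all add: p_PMF_has_derivative mf_density_mono(1))

end

section \<open>Vanishing coupling\<close>

text \<open>
  The infimum is over profiles of finite density. If the ideal gas profile has infinite density, it
  is not attained, but the truncations of that profile approach it.
\<close>

lemma ideal_gas_infimum:
  assumes \<alpha>: "\<alpha> \<le> 0"
  shows "p_PMF d \<beta> \<alpha> 0 0 = 0"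
proof -
  have H: "H_PMF_lsc 0 0 x = (if D x = \<infinity> then \<infinity> else 0)" if "x \<in> l1_plus" for x
    using D_nonneg[OF that] by (simp add: H_PMF_lsc_def zero_ereal_def[symmetric] divide_ereal_def)
  have "0 \<le> (INF y\<in>l1_plus. I_rate d \<beta> \<alpha> y + H_PMF_lsc 0 0 y)"
    using H I_rate_nonneg[OF \<alpha>] by (intro INF_greatest) auto
  moreover have "(INF y\<in>l1_plus. I_rate d \<beta> \<alpha> y + H_PMF_lsc 0 0 y) \<le> 0"
  proof (rule tendsto_lowerbound)
    let ?tail = "\<lambda>K. \<Sum>k. q d \<beta> \<alpha> (Suc (k + K))"
    have "?tail \<longlonglongrightarrow> 0" using suminf_exist_split2[OF q_summable[OF \<alpha>]] .
    then have "(\<lambda>K. ?tail K / \<beta>) \<longlonglongrightarrow> 0" by (rule tendsto_divide_zero)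
    then show "(\<lambda>K. ereal (?tail K / \<beta>)) \<longlonglongrightarrow> 0" by (simp add: zero_ereal_def)
    show "\<forall>\<^sub>F K in sequentially. (INF y\<in>l1_plus. I_rate d \<beta> \<alpha> y + H_PMF_lsc 0 0 y) \<le> ereal (?tail K / \<beta>)"
    proof (intro always_eventually allI)
      fix K
      let ?x = "\<lambda>k. if k \<in> {1..K} then q d \<beta> \<alpha> k else 0"
      have x: "?x \<in> l1_plus"
      proof -
        have "summable ?x" by (rule summable_finite[of "{1..K}"]) auto
        moreover have "0 \<le> ?x k" for k using q_pos[of \<alpha>] by (cases k) (simp_all add: less_imp_le)
        ultimately show ?thesis by (simp add: l1_plus_def)
      qed
      have "(\<lambda>k. real (Suc k) * ?x (Suc k)) sums (\<Sum>k<K. real (Suc k) * ?x (Suc k))"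
        by (rule sums_finite) auto
      then have "D ?x = ereal (\<Sum>k<K. real (Suc k) * ?x (Suc k))"
        using x by (intro D_finite_iff[THEN iffD2]) (simp_all only: l1_plus_def mem_Collect_eq)
      then have "D ?x \<noteq> \<infinity>" by simp
      moreover have "I_rate d \<beta> \<alpha> ?x = ereal (?tail K / \<beta>)"
      proof -
        have "(\<lambda>k. q d \<beta> \<alpha> (Suc (k + K)) / \<beta>) sums (?tail K / \<beta>)"
          using summable_iff_shift[of "\<lambda>k. q d \<beta> \<alpha> (Suc k)" K] q_summable[OF \<alpha>]
          by (intro sums_divide summable_sums) simp
        then have "(\<lambda>k. rel_ent (?x (Suc k)) (q d \<beta> \<alpha> (Suc k)) / \<beta>) sums
            (?tail K / \<beta> + (\<Sum>k<K. rel_ent (?x (Suc k)) (q d \<beta> \<alpha> (Suc k)) / \<beta>))"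
          by (subst sums_iff_shift'[symmetric, of _ _ K]) (simp add: rel_ent_def)
        moreover have "(\<Sum>k<K. rel_ent (?x (Suc k)) (q d \<beta> \<alpha> (Suc k)) / \<beta>) = 0"
          using q_pos[of \<alpha>] by (intro sum.neutral) (simp add: rel_ent_def less_imp_neq[symmetric])
        ultimately have "(\<lambda>k. ereal (rel_ent (?x (Suc k)) (q d \<beta> \<alpha> (Suc k)) / \<beta>)) sums ereal (?tail K / \<beta>)"
          by (simp only: add_0_right sums_ereal)
        then show ?thesis using I_rate_sums[OF \<alpha> x] by (rule sums_unique2[symmetric])
      qed
      ultimately show "(INF y\<in>l1_plus. I_rate d \<beta> \<alpha> y + H_PMF_lsc 0 0 y) \<le> ereal (?tail K / \<beta>)"
        using H[OF x] by (intro INF_lower2[OF x]) simp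
    qed
  qed simp
  ultimately have "(INF y\<in>l1_plus. I_rate d \<beta> \<alpha> y + H_PMF_lsc 0 0 y) = 0" by (rule antisym[rotated])
  then show ?thesis by (simp add: p_PMF_def)
qed

lemma p_PMF_zero_coupling_pos:
  assumes \<alpha>: "\<alpha> \<le> 0" and \<mu>: "0 < \<mu>"
  shows "p_PMF d \<beta> \<alpha> \<mu> 0 = \<infinity>"
proof -
  let ?x = "\<lambda>k::nat. 0::real"
  have x: "?x \<in> l1_plus" by (simp add: l1_plus_def)
  have "I_rate d \<beta> \<alpha> ?x = ereal (qbar d \<beta> \<alpha> / \<beta>)"
    by (simp add: I_rate_def zero_ereal_def[symmetric])
  moreover have "H_PMF_lsc \<mu> 0 ?x = -\<infinity>"
    using \<mu> by (simp add: H_PMF_lsc_def D_def zero_ereal_def[symmetric] divide_ereal_def)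
  ultimately have "I_rate d \<beta> \<alpha> ?x + H_PMF_lsc \<mu> 0 ?x = -\<infinity>" by simp
  then have "(INF y\<in>l1_plus. I_rate d \<beta> \<alpha> y + H_PMF_lsc \<mu> 0 y) \<le> -\<infinity>"
    by (intro INF_lower2[OF x]) simp
  then show ?thesis by (simp add: p_PMF_def)
qed

end

section \<open>Poisson fields\<close>

text \<open>
  A form of Stirling's bound with an explicit error, valid for all \<open>n\<close>; the terms with \<open>ln 0 = 0\<close>
  vanish for \<open>n = 0\<close>.
\<close>

lemma ln_fact_le: "ln (fact n :: real) \<le> real n * ln (real n) - real n + 1 + ln (real n)"
proof (cases "n = 0")
  case False
  then have "1 \<le> n" by simp
  then show ?thesis
  proof (induction n rule: dec_induct)
    case (step n)
    have n: "0 < real n" using step by simp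
    have "ln (real n / real (Suc n)) \<le> real n / real (Suc n) - 1"
      using n by (intro ln_le_minus_one) simp
    then have "ln (real n) - ln (real (Suc n)) \<le> real n / real (Suc n) - 1"
      using n by (simp add: ln_div)
    also have "real n / real (Suc n) - 1 = - 1 / real (Suc n)"
      by (simp add: field_simps)
    finally have "real (Suc n) * (ln (real n) - ln (real (Suc n))) \<le> real (Suc n) * (- 1 / real (Suc n))"
      by (intro mult_left_mono) simp_all
    then have "real (Suc n) * ln (real n) \<le> real (Suc n) * ln (real (Suc n)) - 1"
      by (simp add: algebra_simps)
    then have "real n * ln (real n) + ln (real n) \<le> real (Suc n) * ln (real (Suc n)) - 1"
      by (simp add: algebra_simps)
    moreover have "ln (fact (Suc n) :: real) = ln (real (Suc n)) + ln (fact n)"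
      by (simp only: fact_Suc of_nat_mult) (simp add: ln_mult)
    ultimately show ?case using step by simp
  qed simp
qed simp

lemma poisson_mgf:
  assumes "0 < r"
  shows "(\<integral>\<^sup>+n. ennreal (exp (t * real n)) \<partial>measure_pmf (poisson_pmf r)) = ennreal (exp (r * exp t - r))"
proof -
  have "(\<lambda>n. (r * exp t) ^ n /\<^sub>R fact n) sums exp (r * exp t)" by (rule exp_converges)
  then have "(\<lambda>n. (r * exp t) ^ n /\<^sub>R fact n * exp (- r)) sums (exp (r * exp t) * exp (- r))"
    by (rule sums_mult2)
  moreover have "(r * exp t) ^ n /\<^sub>R fact n * exp (- r) = pmf (poisson_pmf r) n * exp (t * real n)" for n
    using assms by (simp add: power_mult_distrib exp_of_nat_mult[symmetric] field_simps)
  ultimately have sums: "(\<lambda>n. pmf (poisson_pmf r) n * exp (t * real n)) sums exp (r * exp t - r)"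
    by (simp add: exp_diff exp_minus divide_inverse)
  have "(\<integral>\<^sup>+n. ennreal (exp (t * real n)) \<partial>measure_pmf (poisson_pmf r))
      = (\<integral>\<^sup>+n. ennreal (pmf (poisson_pmf r) n * exp (t * real n)) \<partial>count_space UNIV)"
    by (simp add: nn_integral_measure_pmf ennreal_mult)
  also have "\<dots> = (\<Sum>n. ennreal (pmf (poisson_pmf r) n * exp (t * real n)))"
    by (rule nn_integral_count_space_nat)
  also have "\<dots> = ennreal (exp (r * exp t - r))"
    using sums by (intro suminf_ennreal_eq) simp_all
  finally show ?thesis .
qed

definition poisson_field :: "(nat \<Rightarrow> real) \<Rightarrow> (nat \<Rightarrow> nat) measure" where
  "poisson_field r = (\<Pi>\<^sub>M k\<in>{1..}. measure_pmf (poisson_pmf (r k)))"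

lemma poisson_field_mgf:
  assumes "\<And>k. 0 < r (Suc k)"
  shows "(\<integral>\<^sup>+n. ennreal (\<Prod>k<K. exp (t k * real (n (Suc k)))) \<partial>poisson_field r)
       = ennreal (\<Prod>k<K. exp (r (Suc k) * exp (t k) - r (Suc k)))"
proof -
  let ?M = "\<lambda>k. measure_pmf (poisson_pmf (r k))"
  interpret product_prob_space ?M "{1..}"
    by (intro product_prob_spaceI prob_space_measure_pmf)
  let ?g = "\<lambda>i n. ennreal (exp (t (i - 1) * real n))"
  have "(\<integral>\<^sup>+n. ennreal (\<Prod>k<K. exp (t k * real (n (Suc k)))) \<partial>poisson_field r)
      = (\<integral>\<^sup>+n. (\<Prod>i\<in>{Suc 0..K}. ?g i (restrict n {Suc 0..K} i)) \<partial>PiM {1..} ?M)"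
    unfolding poisson_field_def
    by (intro nn_integral_cong) (simp add: prod.atLeast1_atMost_eq prod_ennreal)
  also have "\<dots> = (\<integral>\<^sup>+n. (\<Prod>i\<in>{Suc 0..K}. ?g i (n i))
      \<partial>distr (PiM {1..} ?M) (PiM {Suc 0..K} ?M) (\<lambda>x. restrict x {Suc 0..K}))"
    by (subst nn_integral_distr) (auto intro!: measurable_restrict_subset borel_measurable_prod_ennreal
        measurable_compose[OF measurable_component_singleton])
  also have "distr (PiM {1..} ?M) (PiM {Suc 0..K} ?M) (\<lambda>x. restrict x {Suc 0..K}) = PiM {Suc 0..K} ?M"
    by (rule distr_PiM_restrict_finite) auto
  also have "(\<integral>\<^sup>+n. (\<Prod>i\<in>{Suc 0..K}. ?g i (n i)) \<partial>PiM {Suc 0..K} ?M) = (\<Prod>i\<in>{Suc 0..K}. \<integral>\<^sup>+n. ?g i n \<partial>?M i)"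
    by (rule product_nn_integral_prod) auto
  also have "\<dots> = ennreal (\<Prod>k<K. exp (r (Suc k) * exp (t k) - r (Suc k)))"
    by (simp add: prod.atLeast1_atMost_eq poisson_mgf[OF assms] prod_ennreal)
  finally show ?thesis .
qed

text \<open>
  A configuration with finitely many nonzero entries is an atom, even though the product is
  infinite: the probability that all other entries vanish is positive since the intensities
  are summable.
\<close>

lemma poisson_field_atom:
  assumes r: "\<And>k. 0 < r (Suc k)" "(\<lambda>k. r (Suc k)) sums R" and n: "\<And>k. K \<le> k \<Longrightarrow> n (Suc k) = 0"
  shows "ennreal ((\<Prod>k<K. r (Suc k) ^ n (Suc k) / fact (n (Suc k))) * exp (- R))
       \<le> emeasure (poisson_field r) {restrict n {1..}}"
proof -
  let ?M = "\<lambda>k. measure_pmf (poisson_pmf (r k))"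
  let ?w = "\<lambda>k. r (Suc k) ^ n (Suc k) / fact (n (Suc k))"
  interpret product_prob_space ?M "{1..}"
    by (intro product_prob_spaceI prob_space_measure_pmf)
  define B where "B j = {x \<in> space (PiM {1..} ?M). \<forall>i\<in>{Suc 0..j}. x i \<in> {n i}}" for j
  have sets: "B j \<in> sets (PiM {1..} ?M)" for j
  proof -
    have "B j = prod_emb {1..} ?M {Suc 0..j} (\<Pi>\<^sub>E i\<in>{Suc 0..j}. {n i})"
      by (auto simp: B_def prod_emb_def space_PiM PiE_iff) (metis atLeast_iff extensional_arb)
    then show ?thesis by (simp add: sets_PiM_I)
  qed
  have Int: "(\<Inter>j. B j) = {restrict n {1..}}"
    by (auto simp: B_def space_PiM PiE_iff extensional_def restrict_def fun_eq_iff Suc_le_eq)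
      (metis atLeastAtMost_iff le_refl Suc_leI)
  have lim: "(\<lambda>j. emeasure (PiM {1..} ?M) (B j)) \<longlonglongrightarrow> emeasure (PiM {1..} ?M) (\<Inter>j. B j)"
  proof (rule Lim_emeasure_decseq)
    show "decseq B" by (auto simp: decseq_def B_def)
    show "emeasure (PiM {1..} ?M) (B j) \<noteq> \<infinity>" for j using P.emeasure_finite by simp
  qed (use sets in auto)
  have le: "ennreal ((\<Prod>k<K. ?w k) * exp (- R)) \<le> emeasure (PiM {1..} ?M) (B j)" if "K \<le> j" for j
  proof -
    have "emeasure (PiM {1..} ?M) (B j) = (\<Prod>i\<in>{Suc 0..j}. emeasure (?M i) {n i})"
      unfolding B_def by (rule emeasure_PiM_Collect) auto
    also have "\<dots> = (\<Prod>k<j. ennreal (?w k * exp (- r (Suc k))))"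
      by (simp add: prod.atLeast1_atMost_eq emeasure_pmf_single r(1))
    also have "\<dots> = ennreal (\<Prod>k<j. ?w k * exp (- r (Suc k)))"
      using r(1) by (intro prod_ennreal) (simp add: less_imp_le)
    also have "(\<Prod>k<j. ?w k * exp (- r (Suc k))) = (\<Prod>k<j. ?w k) * exp (- (\<Sum>k<j. r (Suc k)))"
      by (simp only: prod.distrib sum_negf[symmetric] exp_sum[OF finite_lessThan])
    also have "(\<Prod>k<j. ?w k) = (\<Prod>k<K. ?w k)"
      using that n by (intro prod.mono_neutral_right) auto
    finally have eq: "emeasure (PiM {1..} ?M) (B j)
      = ennreal ((\<Prod>k<K. ?w k) * exp (- (\<Sum>k<j. r (Suc k))))" .
    have "(\<Sum>k<j. r (Suc k)) \<le> R"
      using r by (metis finite_lessThan less_imp_le sum_le_suminf sums_iff)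
    then show ?thesis
      unfolding eq using r(1) by (intro ennreal_leI mult_left_mono prod_nonneg) (simp_all add: less_imp_le)
  qed
  show ?thesis
    unfolding poisson_field_def Int[symmetric]
    by (rule Lim_bounded2[OF lim, of K]) (use le in auto)
qed

section \<open>The partition function\<close>

text \<open>
  Summability is expressed through the Cauchy property of the partial sums, which is a measurable
  condition.
\<close>

lemma l1_plus_sets: "l1_plus \<in> sets (\<Pi>\<^sub>M k\<in>(UNIV::nat set). (borel :: real measure))"
proof -
  let ?S = "\<Pi>\<^sub>M k\<in>(UNIV::nat set). (borel :: real measure)"
  have [measurable]: "(\<lambda>x. x k) \<in> borel_measurable ?S" for k :: nat
    by (rule measurable_component_singleton) simp
  have [measurable]: "(\<lambda>x. sum x {..<n}) \<in> borel_measurable ?S" for n :: nat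
    using borel_measurable_sum[of "{..<n}" "\<lambda>k x. x k" ?S] by simp
  have [measurable]: "Measurable.pred ?S (\<lambda>x. Cauchy (\<lambda>n. sum x {..<n}))"
    unfolding pred_def by (rule sets_Collect_Cauchy) measurable
  have "l1_plus = {x \<in> space ?S. x 0 \<le> 0 \<and> (\<forall>k. 0 \<le> x k) \<and> Cauchy (\<lambda>n. sum x {..<n})}"
    by (auto simp: l1_plus_def space_PiM Cauchy_convergent_iff summable_iff_convergent intro: antisym)
  also have "\<dots> \<in> sets ?S" by measurable
  finally show ?thesis .
qed

lemma rescale_measurable:
  "(\<lambda>n k. if k = 0 then 0 else real (n k) / V) \<in> poisson_field r \<rightarrow>\<^sub>M (\<Pi>\<^sub>M k\<in>UNIV. borel)"
proof (rule measurable_PiM_single')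
  fix k :: nat
  show "(\<lambda>n. if k = 0 then 0 else real (n k) / V) \<in> borel_measurable (poisson_field r)"
  proof (cases "k = 0")
    case False
    then have "(\<lambda>n. n k) \<in> poisson_field r \<rightarrow>\<^sub>M measure_pmf (poisson_pmf (r k))"
      unfolding poisson_field_def by (intro measurable_component_singleton) simp
    then have "(\<lambda>n. real (n k) / V) \<in> borel_measurable (poisson_field r)"
      by (rule measurable_compose) simp
    then show ?thesis using False by simp
  qed simp
qed (auto simp: space_PiM)

lemma nn_integral_nu:
  "nn_integral (nu d \<beta> \<alpha> N) f
     = nn_integral (distr (poisson_field (\<lambda>k. vol d N * q d \<beta> \<alpha> k)) (\<Pi>\<^sub>M k\<in>UNIV. borel)
         (\<lambda>n k. if k = 0 then 0 else real (n k) / vol d N)) (\<lambda>x. f x * indicator l1_plus x)"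
  unfolding nu_def poisson_field_def
  by (rule nn_integral_restrict_space) (simp add: l1_plus_sets space_PiM)

lemma log_ext_le: "z \<le> ennreal (exp u) \<Longrightarrow> log_ext z \<le> ereal u"
proof -
  assume z: "z \<le> ennreal (exp u)"
  show ?thesis
  proof (cases z)
    case (real r)
    then have "r \<le> exp u" using z by simp
    moreover have "ln r \<le> u" if "0 < r"
      using that \<open>r \<le> exp u\<close> by (metis exp_gt_zero ln_exp ln_le_cancel_iff)
    ultimately show ?thesis using real by (auto simp: log_ext_def)
  qed (use z in \<open>simp add: top_unique\<close>)
qed

lemma le_log_ext: "ennreal (exp u) \<le> z \<Longrightarrow> ereal u \<le> log_ext z"
proof -
  assume z: "ennreal (exp u) \<le> z"
  show ?thesis
  proof (cases z)
    case (real r)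
    then have r: "exp u \<le> r" using z by simp
    then have "0 < r" using exp_gt_zero[of u] by linarith
    moreover have "u \<le> ln r" using r \<open>0 < r\<close> by (metis exp_gt_zero ln_exp ln_le_cancel_iff)
    ultimately show ?thesis using real by (auto simp: log_ext_def)
  qed (simp add: log_ext_def)
qed

context bose_gas
begin

lemma vol_pos: "1 \<le> N \<Longrightarrow> 0 < vol d N"
  by (simp add: vol_def)

lemma vol_at_top: "filterlim (vol d) at_top sequentially"
proof -
  have "filterlim (\<lambda>N. real N) at_top sequentially" by (rule filterlim_real_sequentially)
  then show ?thesis
  proof (rule filterlim_at_top_mono)
    show "\<forall>\<^sub>F N in sequentially. real N \<le> vol d N"
      using eventually_ge_at_top[of 1]
    proof eventually_elim
      case (elim N)
      have "(2 * real N) ^ 1 \<le> (2 * real N) ^ d" using elim dim_pos by (intro power_increasing) auto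
      then show ?case by (simp add: vol_def)
    qed
  qed
qed

text \<open>
  The tangent bound inside the expectation leaves an exponential moment of the number of particles
  with nonpositive exponent. Dropping the cycles longer than \<open>K\<close> only increases it, and the
  remaining expectation factorises into moment generating functions.
\<close>

lemma Z_PMF_le:
  assumes \<alpha>: "\<alpha> \<le> 0" and a: "0 \<le> a" and m: "\<mu> \<le> a * m" and N: "1 \<le> N"
  shows "Z_PMF d \<beta> \<alpha> \<mu> a N \<le> ennreal (exp (\<beta> * vol d N * mf_dual \<alpha> \<mu> a m))"
proof -
  define V where "V = vol d N"
  define \<theta> where "\<theta> = \<mu> - a * m"
  have V: "0 < V" using vol_pos[OF N] by (simp add: V_def)
  have \<theta>: "\<theta> \<le> 0" using m by (simp add: \<theta>_def)
  let ?S = "\<Pi>\<^sub>M k\<in>(UNIV::nat set). (borel :: real measure)"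
  let ?T = "\<lambda>n k. if k = 0 then 0 else real (n k) / V"
  let ?P = "poisson_field (\<lambda>k. V * q d \<beta> \<alpha> k)"
  let ?f = "\<lambda>x. exp_ext (- (ereal (\<beta> * V) * H_PMF \<mu> a x))"
  let ?c = "\<beta> * V * (a / 2 * m\<^sup>2)"
  define U where "U K = ?c + V * (\<Sum>k<K. q d \<beta> (\<alpha> + \<theta>) (Suc k) - q d \<beta> \<alpha> (Suc k))" for K
  have bound: "Z_PMF d \<beta> \<alpha> \<mu> a N \<le> ennreal (exp (U K))" for K
  proof -
    let ?g = "\<lambda>x. ennreal (exp (?c + \<beta> * V * \<theta> * (\<Sum>k<K. real (Suc k) * x (Suc k))))"
    have pointwise: "?f x \<le> ?g x" if x: "x \<in> l1_plus" for x
    proof (cases "D x")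
      case (real s)
      have x_nonneg: "0 \<le> x k" for k using x by (simp add: l1_plus_def)
      have "(\<Sum>k<K. real (Suc k) * x (Suc k)) \<le> s"
        using real x_nonneg by (auto simp: D_finite_iff sums_iff intro!: sum_le_suminf)
      then have "\<theta> * s \<le> \<theta> * (\<Sum>k<K. real (Suc k) * x (Suc k))"
        using \<theta> by (rule mult_left_mono_neg)
      moreover have "- (- \<mu> * s + a / 2 * s\<^sup>2) \<le> \<theta> * s + a / 2 * m\<^sup>2"
        using square_dual[OF a, of \<mu> m s] by (simp add: \<theta>_def algebra_simps)
      ultimately have "- (- \<mu> * s + a / 2 * s\<^sup>2)
          \<le> a / 2 * m\<^sup>2 + \<theta> * (\<Sum>k<K. real (Suc k) * x (Suc k))" by linarith
      then have "\<beta> * V * - (- \<mu> * s + a / 2 * s\<^sup>2)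
          \<le> \<beta> * V * (a / 2 * m\<^sup>2 + \<theta> * (\<Sum>k<K. real (Suc k) * x (Suc k)))"
        using V beta_pos by (intro mult_left_mono) simp_all
      then have "exp (- (\<beta> * V * (- \<mu> * s + a / 2 * s\<^sup>2)))
          \<le> exp (?c + \<beta> * V * \<theta> * (\<Sum>k<K. real (Suc k) * x (Suc k)))"
        by (simp only: exp_le_cancel_iff distrib_left mult.assoc mult_minus_right)
      moreover have "?f x = ennreal (exp (- (\<beta> * V * (- \<mu> * s + a / 2 * s\<^sup>2))))"
        by (simp add: exp_ext_def H_PMF_def real)
      ultimately show ?thesis by (simp only: ennreal_leI)
    qed (use D_nonneg[OF x] V beta_pos in \<open>simp_all add: exp_ext_def H_PMF_def\<close>)
    have [measurable]: "(\<lambda>x. x k) \<in> borel_measurable ?S" for k :: nat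
      by (rule measurable_component_singleton) simp
    have "Z_PMF d \<beta> \<alpha> \<mu> a N = (\<integral>\<^sup>+x. ?f x * indicator l1_plus x \<partial>distr ?P ?S ?T)"
      unfolding Z_PMF_def nn_integral_nu V_def ..
    also have "\<dots> \<le> (\<integral>\<^sup>+x. ?g x \<partial>distr ?P ?S ?T)"
      using pointwise by (intro nn_integral_mono) (auto simp: indicator_def)
    also have "\<dots> = (\<integral>\<^sup>+n. ?g (?T n) \<partial>?P)"
      by (rule nn_integral_distr[OF rescale_measurable]) measurable
    also have "\<dots> = (\<integral>\<^sup>+n. ennreal (exp ?c) * ennreal (\<Prod>k<K. exp (\<beta> * real (Suc k) * \<theta> * real (n (Suc k)))) \<partial>?P)"
    proof (intro nn_integral_cong)
      fix n :: "nat \<Rightarrow> nat"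
      have "\<beta> * V * \<theta> * (\<Sum>k<K. real (Suc k) * ?T n (Suc k)) = (\<Sum>k<K. \<beta> * real (Suc k) * \<theta> * real (n (Suc k)))"
        unfolding sum_distrib_left using V by (intro sum.cong) (simp_all add: field_simps)
      then show "?g (?T n) = ennreal (exp ?c) * ennreal (\<Prod>k<K. exp (\<beta> * real (Suc k) * \<theta> * real (n (Suc k))))"
        by (simp only: exp_add exp_sum[OF finite_lessThan] ennreal_mult exp_ge_zero prod_nonneg)
    qed
    also have "\<dots> = ennreal (exp ?c) * (\<integral>\<^sup>+n. ennreal (\<Prod>k<K. exp (\<beta> * real (Suc k) * \<theta> * real (n (Suc k)))) \<partial>?P)"
    proof (rule nn_integral_cmult)
      have [measurable]: "(\<lambda>n. real (n (Suc k))) \<in> borel_measurable ?P" for k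
        unfolding poisson_field_def
        by (rule measurable_compose[OF measurable_component_singleton]) simp_all
      show "(\<lambda>n. ennreal (\<Prod>k<K. exp (\<beta> * real (Suc k) * \<theta> * real (n (Suc k))))) \<in> borel_measurable ?P"
        by measurable
    qed
    also have "(\<integral>\<^sup>+n. ennreal (\<Prod>k<K. exp (\<beta> * real (Suc k) * \<theta> * real (n (Suc k)))) \<partial>?P)
        = ennreal (\<Prod>k<K. exp (V * q d \<beta> \<alpha> (Suc k) * exp (\<beta> * real (Suc k) * \<theta>) - V * q d \<beta> \<alpha> (Suc k)))"
      using q_pos V by (intro poisson_field_mgf) simp
    also have "ennreal (exp ?c) * \<dots> = ennreal (exp (U K))"
      by (simp add: U_def q_tilt exp_add exp_sum sum_distrib_left right_diff_distrib mult.assoc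
          ennreal_mult' prod_nonneg)
    finally show ?thesis .
  qed
  have "(\<lambda>k. q d \<beta> (\<alpha> + \<theta>) (Suc k) - q d \<beta> \<alpha> (Suc k)) sums (qbar d \<beta> (\<alpha> + \<theta>) - qbar d \<beta> \<alpha>)"
    using \<alpha> \<theta> by (intro sums_diff qbar_sums) simp_all
  then have "U \<longlonglongrightarrow> ?c + V * (qbar d \<beta> (\<alpha> + \<theta>) - qbar d \<beta> \<alpha>)"
    unfolding U_def sums_def by (intro tendsto_intros)
  moreover have "?c + V * (qbar d \<beta> (\<alpha> + \<theta>) - qbar d \<beta> \<alpha>) = \<beta> * V * mf_dual \<alpha> \<mu> a m"
    using beta_pos by (simp add: mf_dual_def p_ideal_def \<theta>_def field_simps)
  ultimately have "(\<lambda>K. ennreal (exp (U K))) \<longlonglongrightarrow> ennreal (exp (\<beta> * V * mf_dual \<alpha> \<mu> a m))"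
    by (intro tendsto_ennrealI tendsto_exp) simp
  then show ?thesis
    unfolding V_def by (rule Lim_bounded2) (use bound in \<open>auto simp: V_def\<close>)
qed

text \<open>
  Only one configuration is kept in the expectation. That this loses nothing on the exponential
  scale is the content of Stirling's formula.
\<close>

lemma Z_PMF_ge_atom:
  assumes \<alpha>: "\<alpha> \<le> 0" and N: "1 \<le> N" and n: "\<And>k. K \<le> k \<Longrightarrow> n (Suc k) = 0"
  defines "V \<equiv> vol d N"
  defines "s \<equiv> (\<Sum>k<K. real (Suc k) * (real (n (Suc k)) / V))"
  shows "ennreal (exp (\<beta> * V * (\<mu> * s - a / 2 * s\<^sup>2) - V * qbar d \<beta> \<alpha>
        + (\<Sum>k<K. real (n (Suc k)) * ln (V * q d \<beta> \<alpha> (Suc k)) - ln (fact (n (Suc k))))))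
      \<le> Z_PMF d \<beta> \<alpha> \<mu> a N"
proof -
  have V: "0 < V" using vol_pos[OF N] by (simp add: V_def)
  let ?S = "\<Pi>\<^sub>M k\<in>(UNIV::nat set). (borel :: real measure)"
  let ?T = "\<lambda>n k. if k = 0 then 0 else real (n k) / V"
  let ?P = "poisson_field (\<lambda>k. V * q d \<beta> \<alpha> k)"
  let ?f = "\<lambda>x. exp_ext (- (ereal (\<beta> * V) * H_PMF \<mu> a x))"
  define x where "x = ?T n"
  have x_zero: "x k = 0" if "k \<notin> {1..K}" for k
    using that n[of "k - 1"] by (cases k) (auto simp: x_def)
  have "summable x" by (rule summable_finite[of "{1..K}"]) (use x_zero in auto)
  then have x: "x \<in> l1_plus" using V by (simp add: l1_plus_def x_def)
  have "(\<lambda>k. real (Suc k) * x (Suc k)) sums (\<Sum>k<K. real (Suc k) * x (Suc k))"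
    by (rule sums_finite) (use x_zero in auto)
  then have D: "D x = ereal s"
    by (intro D_finite_iff[THEN iffD2]) (use V in \<open>simp_all add: s_def x_def\<close>)
  have fx: "?f x = ennreal (exp (\<beta> * V * (\<mu> * s - a / 2 * s\<^sup>2)))"
    by (simp add: exp_ext_def H_PMF_def D algebra_simps)
  have singleton: "{x} \<in> sets ?S"
  proof -
    have "{x} = (\<Pi>\<^sub>E k\<in>UNIV. {x k})" by (auto simp: PiE_def fun_eq_iff)
    then show ?thesis by (simp add: sets_PiM_I_countable)
  qed
  have sub: "{restrict n {1..}} \<subseteq> ?T -` {x} \<inter> space ?P"
    by (auto simp: x_def fun_eq_iff poisson_field_def space_PiM)
  have pre: "?T -` {x} \<inter> space ?P \<in> sets ?P"
    by (rule measurable_sets[OF rescale_measurable singleton])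
  let ?w = "\<lambda>k. (V * q d \<beta> \<alpha> (Suc k)) ^ n (Suc k) / fact (n (Suc k))"
  have w: "?w k = exp (real (n (Suc k)) * ln (V * q d \<beta> \<alpha> (Suc k)) - ln (fact (n (Suc k))))" for k
    using V q_pos[of \<alpha> k] by (simp add: exp_diff exp_of_nat_mult)
  have "ennreal (exp (\<beta> * V * (\<mu> * s - a / 2 * s\<^sup>2) - V * qbar d \<beta> \<alpha>
        + (\<Sum>k<K. real (n (Suc k)) * ln (V * q d \<beta> \<alpha> (Suc k)) - ln (fact (n (Suc k))))))
      = ?f x * ennreal ((\<Prod>k<K. ?w k) * exp (- (V * qbar d \<beta> \<alpha>)))"
    unfolding fx w exp_sum[OF finite_lessThan, symmetric] exp_add[symmetric]
    by (subst ennreal_mult[symmetric]) (simp_all add: exp_add[symmetric] algebra_simps)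
  also have "\<dots> \<le> ?f x * emeasure ?P {restrict n {1..}}"
    using V q_pos n qbar_sums[OF \<alpha>] by (intro mult_left_mono poisson_field_atom sums_mult) simp_all
  also have "\<dots> \<le> ?f x * emeasure ?P (?T -` {x} \<inter> space ?P)"
    by (intro mult_left_mono emeasure_mono sub pre) simp
  also have "\<dots> = ?f x * emeasure (distr ?P ?S ?T) {x}"
    by (simp add: emeasure_distr[OF rescale_measurable singleton])
  also have "\<dots> = (\<integral>\<^sup>+y. ?f x * indicator {x} y \<partial>distr ?P ?S ?T)"
    using singleton by (subst nn_integral_cmult_indicator) simp_all
  also have "\<dots> \<le> (\<integral>\<^sup>+y. ?f y * indicator l1_plus y \<partial>distr ?P ?S ?T)"
    using x by (intro nn_integral_mono) (auto simp: indicator_def)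
  also have "\<dots> = Z_PMF d \<beta> \<alpha> \<mu> a N"
    unfolding Z_PMF_def nn_integral_nu V_def ..
  finally show ?thesis .
qed

section \<open>The limiting pressure\<close>

text \<open>
  The value of minus the functional of the variational formula, with the energy that is not
  regularised, at the profile that equals \<open>r\<close> on the first \<open>K\<close> cycle lengths and vanishes beyond.
\<close>

definition trial_pressure :: "real \<Rightarrow> real \<Rightarrow> real \<Rightarrow> nat \<Rightarrow> (nat \<Rightarrow> real) \<Rightarrow> real" where
  "trial_pressure \<alpha> \<mu> a K r =
     (let s = \<Sum>k<K. real (Suc k) * r k in
      \<mu> * s - a / 2 * s\<^sup>2
        - (qbar d \<beta> \<alpha> - (\<Sum>k<K. q d \<beta> \<alpha> (Suc k) - rel_ent (r k) (q d \<beta> \<alpha> (Suc k)))) / \<beta>)"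

lemma ln_poisson_weight_ge:
  assumes V: "0 < V" and w: "0 < w"
  shows "V * (w - rel_ent (real n / V) w - (1 + ln (real n)) / V) \<le> real n * ln (V * w) - ln (fact n)"
proof -
  have "V * (w - rel_ent (real n / V) w) = real n * ln (V * w) - real n * ln (real n) + real n"
  proof (cases "n = 0")
    case False
    then show ?thesis using V w by (simp add: rel_ent_def ln_div ln_mult field_simps)
  qed (simp add: rel_ent_def)
  then show ?thesis using ln_fact_le[of n] V by (simp add: right_diff_distrib)
qed

text \<open>
  The atom that rounds the profile \<open>r\<close> down to a configuration has the right probability up to
  subexponential factors.
\<close>

lemma log_partition_ge_trial:
  assumes \<alpha>: "\<alpha> \<le> 0" and r: "\<And>k. 0 \<le> r k" and c: "c < trial_pressure \<alpha> \<mu> a K r"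
  shows "\<forall>\<^sub>F N in sequentially. ereal c < log_ext (Z_PMF d \<beta> \<alpha> \<mu> a N) / ereal (\<beta> * vol d N)"
proof -
  define n where "n N k = (if k \<in> {1..K} then nat \<lfloor>vol d N * r (k - 1)\<rfloor> else 0)" for N k
  define y where "y N k = real (n N (Suc k)) / vol d N" for N k
  define s where "s N = (\<Sum>k<K. real (Suc k) * y N k)" for N
  define e where "e N k = (1 + ln (real (n N (Suc k)))) / vol d N" for N k
  define L where "L N = \<mu> * s N - a / 2 * (s N)\<^sup>2
      - (qbar d \<beta> \<alpha> - (\<Sum>k<K. q d \<beta> \<alpha> (Suc k) - rel_ent (y N k) (q d \<beta> \<alpha> (Suc k)) - e N k)) / \<beta>" for N
  have n_Suc: "n N (Suc k) = nat \<lfloor>vol d N * r k\<rfloor>" if "k < K" for N k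
    using that by (simp add: n_def)
  have n_le: "real (n N (Suc k)) \<le> vol d N * r k" if "k < K" for N k
    using r[of k] n_Suc[OF that] by (simp add: vol_def)
  have bound: "ereal (L N) \<le> log_ext (Z_PMF d \<beta> \<alpha> \<mu> a N) / ereal (\<beta> * vol d N)" if N: "1 \<le> N" for N
  proof -
    define V where "V = vol d N"
    have V: "0 < V" using vol_pos[OF N] by (simp add: V_def)
    have "(\<Sum>k<K. V * (q d \<beta> \<alpha> (Suc k) - rel_ent (y N k) (q d \<beta> \<alpha> (Suc k)) - e N k))
        \<le> (\<Sum>k<K. real (n N (Suc k)) * ln (V * q d \<beta> \<alpha> (Suc k)) - ln (fact (n N (Suc k))))"
      unfolding y_def e_def V_def[symmetric] by (intro sum_mono ln_poisson_weight_ge V q_pos)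
    moreover have "\<beta> * V * L N = \<beta> * V * (\<mu> * s N - a / 2 * (s N)\<^sup>2) - V * qbar d \<beta> \<alpha>
        + (\<Sum>k<K. V * (q d \<beta> \<alpha> (Suc k) - rel_ent (y N k) (q d \<beta> \<alpha> (Suc k)) - e N k))"
      unfolding L_def sum_distrib_left[symmetric] using beta_pos by (simp add: field_simps)
    ultimately have "\<beta> * V * L N \<le> \<beta> * V * (\<mu> * s N - a / 2 * (s N)\<^sup>2) - V * qbar d \<beta> \<alpha>
        + (\<Sum>k<K. real (n N (Suc k)) * ln (V * q d \<beta> \<alpha> (Suc k)) - ln (fact (n N (Suc k))))"
      by linarith
    then have "ennreal (exp (\<beta> * V * L N)) \<le> ennreal (exp (\<beta> * V * (\<mu> * s N - a / 2 * (s N)\<^sup>2) - V * qbar d \<beta> \<alpha>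
        + (\<Sum>k<K. real (n N (Suc k)) * ln (V * q d \<beta> \<alpha> (Suc k)) - ln (fact (n N (Suc k))))))"
      by (intro ennreal_leI) simp
    also have "\<dots> \<le> Z_PMF d \<beta> \<alpha> \<mu> a N"
      unfolding s_def y_def V_def by (rule Z_PMF_ge_atom[OF \<alpha> N]) (simp add: n_def)
    finally have "ereal (\<beta> * V * L N) \<le> log_ext (Z_PMF d \<beta> \<alpha> \<mu> a N)" by (rule le_log_ext)
    then have "ereal (\<beta> * V * L N) / ereal (\<beta> * V) \<le> log_ext (Z_PMF d \<beta> \<alpha> \<mu> a N) / ereal (\<beta> * V)"
      using V beta_pos by (intro ereal_divide_right_mono) simp_all
    then show ?thesis using V beta_pos by (simp add: V_def)
  qed
  have inv_lim: "(\<lambda>N. 1 / vol d N) \<longlonglongrightarrow> 0"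
    using vol_at_top by (intro tendsto_divide_0[OF tendsto_const] filterlim_at_top_imp_at_infinity)
  have y_lim: "(\<lambda>N. y N k) \<longlonglongrightarrow> r k" if k: "k < K" for k
  proof (rule tendsto_sandwich)
    show "\<forall>\<^sub>F N in sequentially. r k - 1 / vol d N \<le> y N k"
      using eventually_ge_at_top[of 1]
    proof eventually_elim
      case (elim N)
      then have V: "0 < vol d N" by (rule vol_pos)
      have "0 \<le> \<lfloor>vol d N * r k\<rfloor>" using V r[of k] by simp
      then have "vol d N * r k - 1 \<le> real (n N (Suc k))"
        using real_of_int_floor_gt_diff_one[of "vol d N * r k"] n_Suc[OF k] by simp
      then have "(vol d N * r k - 1) / vol d N \<le> y N k"
        using V unfolding y_def by (intro divide_right_mono) simp_all
      then show ?case using V by (simp add: diff_divide_distrib)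
    qed
    show "\<forall>\<^sub>F N in sequentially. y N k \<le> r k"
      using eventually_ge_at_top[of 1]
    proof eventually_elim
      case (elim N)
      then show ?case using n_le[OF k, of N] vol_pos[OF elim] by (simp add: y_def field_simps)
    qed
    show "(\<lambda>N. r k - 1 / vol d N) \<longlonglongrightarrow> r k"
      using tendsto_diff[OF tendsto_const inv_lim, of "r k"] by simp
  qed simp
  have e_lim: "(\<lambda>N. e N k) \<longlonglongrightarrow> 0" if k: "k < K" for k
  proof (rule Lim_null_comparison)
    have "((\<lambda>V. (1 + ln (1 + V * r k)) / V) \<longlongrightarrow> 0) at_top"
    proof (cases "r k = 0")
      case True
      then show ?thesis by simp real_asymp
    next
      case False
      then have "0 < r k" using r[of k] by simp
      then show ?thesis by real_asymp
    qed
    then show "(\<lambda>N. (1 + ln (1 + vol d N * r k)) / vol d N) \<longlonglongrightarrow> 0"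
      by (rule filterlim_compose[OF _ vol_at_top])
    show "\<forall>\<^sub>F N in sequentially. norm (e N k) \<le> (1 + ln (1 + vol d N * r k)) / vol d N"
      using eventually_ge_at_top[of 1]
    proof eventually_elim
      case (elim N)
      then have V: "0 < vol d N" by (rule vol_pos)
      have "0 \<le> ln (real (n N (Suc k)))" by (cases "n N (Suc k) = 0") auto
      moreover have "ln (real (n N (Suc k))) \<le> ln (1 + vol d N * r k)"
        using n_le[OF k, of N] by (cases "n N (Suc k) = 0") (auto simp: V r less_imp_le)
      ultimately show ?case using V by (simp add: e_def divide_right_mono)
    qed
  qed
  have ent_lim: "(\<lambda>N. rel_ent (y N k) (q d \<beta> \<alpha> (Suc k))) \<longlonglongrightarrow> rel_ent (r k) (q d \<beta> \<alpha> (Suc k))"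
    if k: "k < K" for k
  proof (cases "r k = 0")
    case True
    then have "y N k = 0" for N using n_Suc[OF k] by (simp add: y_def)
    then show ?thesis using True by simp
  next
    case False
    then show ?thesis
      unfolding rel_ent_def using q_pos[of \<alpha> k] by (intro tendsto_intros y_lim k) simp_all
  qed
  have s_lim: "s \<longlonglongrightarrow> (\<Sum>k<K. real (Suc k) * r k)"
    unfolding s_def by (intro tendsto_intros y_lim) simp
  have "(\<lambda>N. \<Sum>k<K. q d \<beta> \<alpha> (Suc k) - rel_ent (y N k) (q d \<beta> \<alpha> (Suc k)) - e N k)
      \<longlonglongrightarrow> (\<Sum>k<K. q d \<beta> \<alpha> (Suc k) - rel_ent (r k) (q d \<beta> \<alpha> (Suc k)) - 0)"
    by (intro tendsto_intros ent_lim e_lim) simp_all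
  then have ent_sum: "(\<lambda>N. \<Sum>k<K. q d \<beta> \<alpha> (Suc k) - rel_ent (y N k) (q d \<beta> \<alpha> (Suc k)) - e N k)
      \<longlonglongrightarrow> (\<Sum>k<K. q d \<beta> \<alpha> (Suc k) - rel_ent (r k) (q d \<beta> \<alpha> (Suc k)))"
    by simp
  have "L \<longlonglongrightarrow> trial_pressure \<alpha> \<mu> a K r"
    unfolding L_def trial_pressure_def Let_def using beta_pos
    by (intro tendsto_diff tendsto_mult tendsto_const tendsto_power tendsto_divide s_lim ent_sum) simp
  then have "\<forall>\<^sub>F N in sequentially. c < L N" using c by (rule order_tendstoD)
  then show ?thesis
    using eventually_ge_at_top[of 1]
  proof eventually_elim
    case (elim N)
    then have "ereal c < ereal (L N)" by simp
    also note bound[OF elim(2)]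
    finally show ?case .
  qed
qed

lemma log_partition_le_mf_dual:
  assumes "\<alpha> \<le> 0" "0 \<le> a" "\<mu> \<le> a * m"
  shows "\<forall>\<^sub>F N in sequentially. log_ext (Z_PMF d \<beta> \<alpha> \<mu> a N) / ereal (\<beta> * vol d N) \<le> ereal (mf_dual \<alpha> \<mu> a m)"
  using eventually_ge_at_top[of 1]
proof eventually_elim
  case (elim N)
  then have V: "0 < vol d N" by (rule vol_pos)
  have "log_ext (Z_PMF d \<beta> \<alpha> \<mu> a N) \<le> ereal (\<beta> * vol d N * mf_dual \<alpha> \<mu> a m)"
    using Z_PMF_le[OF assms elim] by (rule log_ext_le)
  then have "log_ext (Z_PMF d \<beta> \<alpha> \<mu> a N) / ereal (\<beta> * vol d N)
      \<le> ereal (\<beta> * vol d N * mf_dual \<alpha> \<mu> a m) / ereal (\<beta> * vol d N)"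
    using V beta_pos by (intro ereal_divide_right_mono) simp_all
  then show ?case using V beta_pos by simp
qed

lemma qbar_tail_lim: "\<alpha> \<le> 0 \<Longrightarrow> (\<lambda>K. qbar d \<beta> \<alpha> - (\<Sum>k<K. q d \<beta> \<alpha> (Suc k))) \<longlonglongrightarrow> 0"
  using tendsto_diff[OF tendsto_const, of _ _ _ "qbar d \<beta> \<alpha>"] qbar_sums[of \<alpha>] unfolding sums_def by fastforce

text \<open>
  Truncations of an ideal gas profile with finite density recover its full contribution.
\<close>

lemma trial_pressure_bose_profile:
  assumes \<alpha>: "\<alpha> \<le> 0" and \<theta>: "\<alpha> + \<theta> \<le> 0" and s: "varrho d \<beta> (\<alpha> + \<theta>) = ereal s"
  shows "(\<lambda>K. trial_pressure \<alpha> \<mu> a K (\<lambda>k. q d \<beta> (\<alpha> + \<theta>) (Suc k)))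
    \<longlonglongrightarrow> \<mu> * s - a / 2 * s\<^sup>2 - \<theta> * s + p_ideal d \<beta> (\<alpha> + \<theta>) - p_ideal d \<beta> \<alpha>"
proof -
  let ?q' = "\<lambda>k. q d \<beta> (\<alpha> + \<theta>) (Suc k)"
  \<comment> \<open>Tilting by \<open>\<theta>\<close> makes the first relative entropy vanish.\<close>
  have summand: "q d \<beta> \<alpha> (Suc k) - rel_ent (?q' k) (q d \<beta> \<alpha> (Suc k))
      = ?q' k - \<beta> * \<theta> * (real (Suc k) * ?q' k)" for k
  proof -
    have "rel_ent (?q' k) (q d \<beta> \<alpha> (Suc k)) = rel_ent (?q' k) (?q' k)
        + (\<beta> * real (Suc k) * \<theta> * ?q' k - (?q' k - q d \<beta> \<alpha> (Suc k)))"
      using rel_ent_tilt[OF less_imp_le[OF q_pos[of "\<alpha> + \<theta>" k]] q_pos[of \<alpha> k], of "\<beta> * real (Suc k) * \<theta>"]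
      by (simp only: q_tilt[symmetric])
    then show ?thesis by (simp add: rel_ent_self[OF q_pos])
  qed
  have S: "(\<lambda>k. real (Suc k) * ?q' k) sums s" using s by (simp only: varrho_finite_iff)
  have "(\<lambda>K. \<Sum>k<K. q d \<beta> \<alpha> (Suc k) - rel_ent (?q' k) (q d \<beta> \<alpha> (Suc k)))
      \<longlonglongrightarrow> qbar d \<beta> (\<alpha> + \<theta>) - \<beta> * \<theta> * s"
    unfolding summand sums_def[symmetric] by (intro sums_diff sums_mult S qbar_sums \<theta>)
  moreover have "(\<lambda>K. \<Sum>k<K. real (Suc k) * ?q' k) \<longlonglongrightarrow> s" using S unfolding sums_def .
  ultimately have "(\<lambda>K. trial_pressure \<alpha> \<mu> a K ?q')
      \<longlonglongrightarrow> \<mu> * s - a / 2 * s\<^sup>2 - (qbar d \<beta> \<alpha> - (qbar d \<beta> (\<alpha> + \<theta>) - \<beta> * \<theta> * s)) / \<beta>"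
    unfolding trial_pressure_def Let_def using beta_pos by (intro tendsto_intros) simp_all
  then show ?thesis
    using beta_pos by (simp add: p_ideal_def diff_divide_distrib add_divide_distrib algebra_simps)
qed

text \<open>
  At \<open>\<alpha> = 0\<close> the weights decay only polynomially. A density \<open>t\<close> of particles in cycles of length
  \<open>k\<close> uses \<open>t / k\<close> cycles, each at a cost of order \<open>ln k\<close>, so long cycles host a condensate for free.
\<close>

lemma long_cycle_cost:
  assumes t: "0 < t"
  shows "(\<lambda>K. rel_ent (t / real (Suc K)) (q d \<beta> 0 (Suc K))) \<longlonglongrightarrow> 0"
proof -
  have "(\<lambda>K. 1 / real (Suc K)) \<longlonglongrightarrow> 0" by real_asymp
  moreover have "(\<lambda>K. ln (real (Suc K)) / real (Suc K)) \<longlonglongrightarrow> 0" by real_asymp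
  moreover have "(\<lambda>K. q d \<beta> 0 (Suc K)) \<longlonglongrightarrow> 0" by (rule summable_LIMSEQ_zero[OF q_summable]) simp
  ultimately have "(\<lambda>K. t * ln (t * thermal_volume) * (1 / real (Suc K))
      + t * (real d / 2) * (ln (real (Suc K)) / real (Suc K)) - t * (1 / real (Suc K)) + q d \<beta> 0 (Suc K))
      \<longlonglongrightarrow> t * ln (t * thermal_volume) * 0 + t * (real d / 2) * 0 - t * 0 + 0"
    by (intro tendsto_intros)
  moreover have "rel_ent (t / real (Suc K)) (q d \<beta> 0 (Suc K)) = t * ln (t * thermal_volume) * (1 / real (Suc K))
      + t * (real d / 2) * (ln (real (Suc K)) / real (Suc K)) - t * (1 / real (Suc K)) + q d \<beta> 0 (Suc K)" for K
  proof -
    have "t / real (Suc K) / q d \<beta> 0 (Suc K)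
        = t * thermal_volume * (real (Suc K) powr (1 + real d / 2) / real (Suc K) powr 1)"
      by (simp add: q_def thermal_volume_def)
    also have "\<dots> = t * thermal_volume * real (Suc K) powr (real d / 2)"
      by (simp only: powr_diff[symmetric]) simp
    finally have "ln (t / real (Suc K) / q d \<beta> 0 (Suc K))
        = ln (t * thermal_volume) + real d / 2 * ln (real (Suc K))"
      using t thermal_volume_pos by (simp add: ln_mult ln_powr)
    then show ?thesis unfolding rel_ent_def by (simp add: algebra_simps add_divide_distrib)
  qed
  ultimately show ?thesis by simp
qed

definition condensate_trial :: "real \<Rightarrow> nat \<Rightarrow> nat \<Rightarrow> real" where
  "condensate_trial t K k = (if k < K then q d \<beta> 0 (Suc k) else t / real (Suc K))"

lemma condensate_trial_nonneg: "0 < t \<Longrightarrow> 0 \<le> condensate_trial t K k"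
  using q_pos[of 0 k] by (simp add: condensate_trial_def less_imp_le)

definition condensate_cost :: "real \<Rightarrow> nat \<Rightarrow> real" where
  "condensate_cost t K = ((qbar d \<beta> 0 - (\<Sum>k<Suc K. q d \<beta> 0 (Suc k)))
     + rel_ent (t / real (Suc K)) (q d \<beta> 0 (Suc K))) / \<beta>"

lemma condensate_cost_lim:
  assumes t: "0 < t"
  shows "condensate_cost t \<longlonglongrightarrow> 0"
proof -
  have "condensate_cost t \<longlonglongrightarrow> (0 + 0) / \<beta>"
    unfolding condensate_cost_def using beta_pos qbar_tail_lim[of 0]
    by (intro tendsto_divide tendsto_add tendsto_const long_cycle_cost t
        LIMSEQ_Suc[of "\<lambda>K. qbar d \<beta> 0 - (\<Sum>k<K. q d \<beta> 0 (Suc k))"]) simp_all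
  then show ?thesis by simp
qed

lemma trial_pressure_condensate:
  "trial_pressure 0 \<mu> a (Suc K) (condensate_trial t K)
     = \<mu> * ((\<Sum>k<K. real (Suc k) * q d \<beta> 0 (Suc k)) + t)
       - a / 2 * ((\<Sum>k<K. real (Suc k) * q d \<beta> 0 (Suc k)) + t)\<^sup>2 - condensate_cost t K"
proof -
  have ent: "(\<Sum>k<Suc K. q d \<beta> 0 (Suc k) - rel_ent (condensate_trial t K k) (q d \<beta> 0 (Suc k)))
      = (\<Sum>k<Suc K. q d \<beta> 0 (Suc k)) - rel_ent (t / real (Suc K)) (q d \<beta> 0 (Suc K))"
    by (simp add: condensate_trial_def rel_ent_self[OF q_pos])
  have dens: "(\<Sum>k<Suc K. real (Suc k) * condensate_trial t K k)
      = (\<Sum>k<K. real (Suc k) * q d \<beta> 0 (Suc k)) + t"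
    by (simp add: condensate_trial_def)
  show ?thesis
    unfolding trial_pressure_def Let_def ent dens condensate_cost_def by (simp add: algebra_simps)
qed

lemma log_partition_limitI:
  assumes \<alpha>: "\<alpha> \<le> 0"
    and upper: "p = \<infinity> \<or> (\<exists>m. 0 \<le> a \<and> \<mu> \<le> a * m \<and> p = ereal (mf_dual \<alpha> \<mu> a m))"
    and lower: "\<And>c. ereal c < p \<Longrightarrow> \<exists>K r. (\<forall>k. 0 \<le> r k) \<and> c < trial_pressure \<alpha> \<mu> a K r"
  shows "(\<lambda>N. log_ext (Z_PMF d \<beta> \<alpha> \<mu> a N) / ereal (\<beta> * vol d N)) \<longlonglongrightarrow> p"
proof (rule order_tendstoI)
  fix y assume "y < p"
  then obtain c where c: "y < ereal c" "ereal c < p" using ereal_dense2 by blast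
  obtain K r where r: "\<And>k. 0 \<le> r k" "c < trial_pressure \<alpha> \<mu> a K r" using lower[OF c(2)] by blast
  have "\<forall>\<^sub>F N in sequentially. ereal c < log_ext (Z_PMF d \<beta> \<alpha> \<mu> a N) / ereal (\<beta> * vol d N)"
    by (rule log_partition_ge_trial[OF \<alpha> r])
  then show "\<forall>\<^sub>F N in sequentially. y < log_ext (Z_PMF d \<beta> \<alpha> \<mu> a N) / ereal (\<beta> * vol d N)"
    by eventually_elim (use c(1) in order)
next
  fix y assume y: "p < y"
  then obtain m where m: "0 \<le> a" "\<mu> \<le> a * m" "p = ereal (mf_dual \<alpha> \<mu> a m)" using upper by auto
  show "\<forall>\<^sub>F N in sequentially. log_ext (Z_PMF d \<beta> \<alpha> \<mu> a N) / ereal (\<beta> * vol d N) < y"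
    using log_partition_le_mf_dual[OF \<alpha> m(1,2)] by eventually_elim (use m(3) y in order)
qed

lemma log_partition_limit_trialI:
  assumes \<alpha>: "\<alpha> \<le> 0" and "0 \<le> a" "\<mu> \<le> a * m" and r: "\<And>K k. 0 \<le> r K k"
    and lim: "(\<lambda>K. trial_pressure \<alpha> \<mu> a (\<kappa> K) (r K)) \<longlonglongrightarrow> mf_dual \<alpha> \<mu> a m"
  shows "(\<lambda>N. log_ext (Z_PMF d \<beta> \<alpha> \<mu> a N) / ereal (\<beta> * vol d N)) \<longlonglongrightarrow> ereal (mf_dual \<alpha> \<mu> a m)"
proof (rule log_partition_limitI[OF \<alpha>])
  show "ereal (mf_dual \<alpha> \<mu> a m) = \<infinity> \<or>
      (\<exists>m'. 0 \<le> a \<and> \<mu> \<le> a * m' \<and> ereal (mf_dual \<alpha> \<mu> a m) = ereal (mf_dual \<alpha> \<mu> a m'))"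
    using assms by (intro disjI2 exI[of _ m]) simp
  fix c assume "ereal c < ereal (mf_dual \<alpha> \<mu> a m)"
  then have "\<forall>\<^sub>F K in sequentially. c < trial_pressure \<alpha> \<mu> a (\<kappa> K) (r K)"
    by (intro order_tendstoD(1)[OF lim]) simp
  then obtain K where "c < trial_pressure \<alpha> \<mu> a (\<kappa> K) (r K)"
    using eventually_happens by fastforce
  then show "\<exists>K r. (\<forall>k. 0 \<le> r k) \<and> c < trial_pressure \<alpha> \<mu> a K r"
    using r by (intro exI[of _ "\<kappa> K"] exI[of _ "r K"]) simp
qed

lemma mf_density_unsaturated:
  assumes \<alpha>: "\<alpha> \<le> 0" and a: "0 \<le> a" and less: "ereal \<mu> < ereal a * varrho d \<beta> \<alpha>"
  shows "mf_density \<alpha> \<mu> a = delta_star d \<beta> \<alpha> \<mu> a"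
  using delta_star_unsaturated(2)[OF assms] a by (simp add: mf_density_def max_def field_simps)

lemma mf_density_saturated:
  assumes "0 < a" "varrho d \<beta> \<alpha> = ereal r" "a * r \<le> \<mu>"
  shows "mf_density \<alpha> \<mu> a = \<mu> / a"
  using delta_star_saturated(2)[OF less_imp_le[OF assms(1)] assms(2,3)] assms
  by (simp add: mf_density_def max_def field_simps)

lemma p_PMF_unsaturated:
  assumes \<alpha>: "\<alpha> \<le> 0" and a: "0 \<le> a" and less: "ereal \<mu> < ereal a * varrho d \<beta> \<alpha>"
  shows "p_PMF d \<beta> \<alpha> \<mu> a = ereal (mf_dual \<alpha> \<mu> a (delta_star d \<beta> \<alpha> \<mu> a))"
proof -
  have "0 < a \<or> a = 0 \<and> \<mu> \<le> 0" using a less by (cases "a = 0") (auto simp: zero_ereal_def[symmetric])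
  then show ?thesis
    using p_PMF_eq_mf_dual[OF \<alpha> _ delta_star_unsaturated(1)[OF assms]] mf_density_unsaturated[OF assms] by simp
qed

lemma p_PMF_saturated:
  assumes \<alpha>: "\<alpha> \<le> 0" and a: "0 < a" and "varrho d \<beta> \<alpha> = ereal r" "a * r \<le> \<mu>"
  shows "p_PMF d \<beta> \<alpha> \<mu> a = ereal (mf_dual \<alpha> \<mu> a (\<mu> / a))" "mf_dual \<alpha> \<mu> a (\<mu> / a) = \<mu>\<^sup>2 / (2 * a)"
  using p_PMF_real[OF \<alpha> a] mf_density_saturated[OF a assms(3,4)] a
  by (simp_all add: mf_dual_def power2_eq_square)

text \<open>
  The profile to be truncated depends on the regime. Without condensate the minimiser has its
  density at least \<open>\<mu> / a\<close>, where the two energies agree. If \<open>\<mu>\<close> exceeds the critical value, which is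
  allowed for \<open>\<alpha> = 0\<close>, the missing density goes into cycles of one very great length. At zero coupling
  and \<open>\<mu> > 0\<close> this density can be made arbitrarily large, so that the pressure diverges.
\<close>

lemma log_partition_limit:
  assumes \<alpha>: "\<alpha> \<le> 0" and a: "0 \<le> a" and regime: "\<alpha> = 0 \<or> ereal \<mu> \<le> ereal a * varrho d \<beta> \<alpha>"
  shows "(\<lambda>N. log_ext (Z_PMF d \<beta> \<alpha> \<mu> a N) / ereal (\<beta> * vol d N)) \<longlonglongrightarrow> p_PMF d \<beta> \<alpha> \<mu> a"
proof (cases "ereal \<mu> < ereal a * varrho d \<beta> \<alpha>")
  case True
  let ?\<delta> = "delta_star d \<beta> \<alpha> \<mu> a"
  let ?\<theta> = "\<mu> - a * ?\<delta>"
  note ds = delta_star_unsaturated[OF \<alpha> a True]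
  have p: "p_PMF d \<beta> \<alpha> \<mu> a = ereal (mf_dual \<alpha> \<mu> a ?\<delta>)" by (rule p_PMF_unsaturated[OF \<alpha> a True])
  have "(\<lambda>K. trial_pressure \<alpha> \<mu> a K (\<lambda>k. q d \<beta> (\<alpha> + ?\<theta>) (Suc k)))
      \<longlonglongrightarrow> \<mu> * ?\<delta> - a / 2 * ?\<delta>\<^sup>2 - ?\<theta> * ?\<delta> + p_ideal d \<beta> (\<alpha> + ?\<theta>) - p_ideal d \<beta> \<alpha>"
    using ds \<alpha> by (intro trial_pressure_bose_profile) (simp_all add: add_diff_eq)
  also have "\<mu> * ?\<delta> - a / 2 * ?\<delta>\<^sup>2 - ?\<theta> * ?\<delta> + p_ideal d \<beta> (\<alpha> + ?\<theta>) - p_ideal d \<beta> \<alpha> = mf_dual \<alpha> \<mu> a ?\<delta>"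
    by (simp add: mf_dual_def algebra_simps power2_eq_square)
  finally have lim: "(\<lambda>K. trial_pressure \<alpha> \<mu> a K (\<lambda>k. q d \<beta> (\<alpha> + ?\<theta>) (Suc k))) \<longlonglongrightarrow> mf_dual \<alpha> \<mu> a ?\<delta>" .
  show ?thesis
    unfolding p using a ds(2) q_pos
    by (intro log_partition_limit_trialI[OF \<alpha> _ _ _ lim]) (simp_all add: less_imp_le)
next
  case False
  then have ge: "ereal a * varrho d \<beta> \<alpha> \<le> ereal \<mu>" by simp
  show ?thesis
  proof (cases "a = 0")
    case a0: True
    then have \<mu>: "0 \<le> \<mu>" using ge by (simp add: zero_ereal_def[symmetric])
    show ?thesis
    proof (cases "\<mu> = 0")
      case True
      have p: "p_PMF d \<beta> \<alpha> \<mu> a = 0" using ideal_gas_infimum[OF \<alpha>] a0 True by simp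
      have tp: "trial_pressure \<alpha> \<mu> a K (\<lambda>k. q d \<beta> \<alpha> (Suc k)) = - (qbar d \<beta> \<alpha> - (\<Sum>k<K. q d \<beta> \<alpha> (Suc k))) / \<beta>" for K
        using True a0 by (simp add: trial_pressure_def rel_ent_self[OF q_pos] diff_divide_distrib)
      have "(\<lambda>K. - (qbar d \<beta> \<alpha> - (\<Sum>k<K. q d \<beta> \<alpha> (Suc k))) / \<beta>) \<longlonglongrightarrow> - 0 / \<beta>"
        using beta_pos by (intro tendsto_intros qbar_tail_lim[OF \<alpha>]) simp
      moreover have dual: "mf_dual \<alpha> \<mu> a 0 = 0" using a0 True by (simp add: mf_dual_def)
      ultimately have lim: "(\<lambda>K. trial_pressure \<alpha> \<mu> a K (\<lambda>k. q d \<beta> \<alpha> (Suc k))) \<longlonglongrightarrow> mf_dual \<alpha> \<mu> a 0"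
        by (simp add: tp)
      have "(\<lambda>N. log_ext (Z_PMF d \<beta> \<alpha> \<mu> a N) / ereal (\<beta> * vol d N)) \<longlonglongrightarrow> ereal (mf_dual \<alpha> \<mu> a 0)"
        using a True q_pos by (intro log_partition_limit_trialI[OF \<alpha> _ _ _ lim]) (simp_all add: less_imp_le)
      then show ?thesis unfolding p dual by (simp only: zero_ereal_def)
    next
      case False
      then have \<mu>: "0 < \<mu>" using \<mu> by simp
      then have \<alpha>0: "\<alpha> = 0" using regime a0 by (simp add: zero_ereal_def[symmetric])
      have p: "p_PMF d \<beta> \<alpha> \<mu> a = \<infinity>" using p_PMF_zero_coupling_pos[OF \<alpha> \<mu>] a0 by simp
      show ?thesis
        unfolding p
      proof (rule log_partition_limitI[OF \<alpha>])
        fix c :: real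
        \<comment> \<open>The margin \<open>1\<close> in \<open>c + 1 \<le> \<mu> * t\<close> pays for the cost of the long cycle.\<close>
        define t where "t = (\<bar>c\<bar> + 1) / \<mu>"
        have t: "0 < t" "c + 1 \<le> \<mu> * t" using \<mu> by (simp_all add: t_def add_pos_nonneg)
        obtain K where K: "condensate_cost t K < 1"
          using eventually_happens[OF order_tendstoD(2)[OF condensate_cost_lim[OF t(1)], of 1]] by auto
        have "0 \<le> \<mu> * (\<Sum>k<K. real (Suc k) * q d \<beta> 0 (Suc k))"
          using \<mu> q_pos[of 0] by (intro mult_nonneg_nonneg sum_nonneg) (simp_all add: less_imp_le)
        then have "c < trial_pressure \<alpha> \<mu> a (Suc K) (condensate_trial t K)"
          unfolding \<alpha>0 trial_pressure_condensate using K t(2) a0 by (simp add: distrib_left)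
        then show "\<exists>K r. (\<forall>k. 0 \<le> r k) \<and> c < trial_pressure \<alpha> \<mu> a K r"
          using condensate_trial_nonneg[OF t(1)]
          by (intro exI[of _ "Suc K"] exI[of _ "condensate_trial t K"]) simp
      qed simp
    qed
  next
    case False
    then have a: "0 < a" using a by simp
    obtain r where r: "varrho d \<beta> \<alpha> = ereal r" "a * r \<le> \<mu>" using a ge by (rule saturatedE)
    note p = p_PMF_saturated[OF \<alpha> a r]
    have m: "\<mu> \<le> a * (\<mu> / a)" using a by simp
    show ?thesis
    proof (cases "\<mu> = a * r")
      case True
      have "(\<lambda>K. trial_pressure \<alpha> \<mu> a K (\<lambda>k. q d \<beta> (\<alpha> + 0) (Suc k)))
          \<longlonglongrightarrow> \<mu> * r - a / 2 * r\<^sup>2 - 0 * r + p_ideal d \<beta> (\<alpha> + 0) - p_ideal d \<beta> \<alpha>"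
        using r(1) \<alpha> by (intro trial_pressure_bose_profile) simp_all
      also have "\<mu> * r - a / 2 * r\<^sup>2 - 0 * r + p_ideal d \<beta> (\<alpha> + 0) - p_ideal d \<beta> \<alpha> = mf_dual \<alpha> \<mu> a (\<mu> / a)"
        unfolding p(2) using a by (simp add: True power2_eq_square)
      finally have lim: "(\<lambda>K. trial_pressure \<alpha> \<mu> a K (\<lambda>k. q d \<beta> (\<alpha> + 0) (Suc k)))
          \<longlonglongrightarrow> mf_dual \<alpha> \<mu> a (\<mu> / a)" .
      show ?thesis
        unfolding p(1) using q_pos
        by (intro log_partition_limit_trialI[OF \<alpha> less_imp_le[OF a] m _ lim]) (simp add: less_imp_le)
    next
      case False
      then have \<alpha>0: "\<alpha> = 0" using regime r by auto
      \<comment> \<open>The condensate tops the density up to \<open>\<mu> / a\<close>, the minimiser of the energy.\<close>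
      define t where "t = \<mu> / a - r"
      have t: "0 < t" using False r(2) a by (simp add: t_def field_simps)
      have "(\<lambda>K. \<Sum>k<K. real (Suc k) * q d \<beta> 0 (Suc k)) \<longlonglongrightarrow> r"
        using r(1) unfolding \<alpha>0 varrho_finite_iff sums_def .
      then have "(\<lambda>K. trial_pressure 0 \<mu> a (Suc K) (condensate_trial t K))
          \<longlonglongrightarrow> \<mu> * (r + t) - a / 2 * (r + t)\<^sup>2 - 0"
        unfolding trial_pressure_condensate
        by (intro tendsto_diff tendsto_mult tendsto_const tendsto_power tendsto_add condensate_cost_lim t)
      also have "\<mu> * (r + t) - a / 2 * (r + t)\<^sup>2 - 0 = mf_dual \<alpha> \<mu> a (\<mu> / a)"
        unfolding p(2) using a by (simp add: t_def power2_eq_square)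
      finally have lim: "(\<lambda>K. trial_pressure \<alpha> \<mu> a (Suc K) (condensate_trial t K))
          \<longlonglongrightarrow> mf_dual \<alpha> \<mu> a (\<mu> / a)" unfolding \<alpha>0 .
      show ?thesis
        unfolding p(1)
        by (rule log_partition_limit_trialI[OF \<alpha> less_imp_le[OF a] m condensate_trial_nonneg[OF t] lim])
    qed
  qed
qed

section \<open>The particle-mean-field model\<close>

lemma PMF_minimiser:
  fixes \<alpha> \<mu> a :: real
  assumes \<alpha>: "\<alpha> \<le> 0" and a: "0 < a"
  defines "\<delta> \<equiv> delta_star d \<beta> \<alpha> \<mu> a" and "\<xi> \<equiv> xi_PMF d \<beta> \<alpha> \<mu> a"
  shows "\<exists>!\<delta>'. delta_eq d \<beta> \<alpha> \<mu> a \<delta>'"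
    and "\<xi> \<in> l1_plus"
    and "\<forall>x\<in>l1_plus. I_PMF d \<beta> \<alpha> \<mu> a x = 0 \<longleftrightarrow> x = \<xi>"
    and "D \<xi> = ereal \<delta>"
    and "\<mu> \<le> 0 \<Longrightarrow>
      0 < \<delta> \<and> ereal \<delta> \<le> varrho d \<beta> (\<alpha> + \<mu> - a * \<delta>) \<and> ereal \<delta> < varrho d \<beta> (\<alpha> + \<mu>)"
proof -
  note eq = delta_star_delta_eq[OF \<alpha> a, of \<mu>]
  have a': "0 < a \<or> a = 0 \<and> \<mu> \<le> 0" using a by simp
  show "\<exists>!\<delta>'. delta_eq d \<beta> \<alpha> \<mu> a \<delta>'" using eq delta_eq_unique a by (metis less_imp_le)
  show "\<xi> \<in> l1_plus" unfolding \<xi>_def by (rule xi_l1[OF \<alpha> a' eq])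
  show "\<forall>x\<in>l1_plus. I_PMF d \<beta> \<alpha> \<mu> a x = 0 \<longleftrightarrow> x = \<xi>"
    unfolding \<xi>_def using I_PMF_eq_0_iff[OF \<alpha> a' eq] by blast
  show "D \<xi> = ereal \<delta>" unfolding \<xi>_def \<delta>_def by (rule D_xi[OF \<alpha> a' eq])
  assume \<mu>: "\<mu> \<le> 0"
  have "0 < ereal a * varrho d \<beta> \<alpha>" using a varrho_pos[of \<alpha>] by (simp add: ereal_zero_less_0_iff)
  moreover have "ereal \<mu> \<le> 0" using \<mu> by simp
  ultimately have "ereal \<mu> < ereal a * varrho d \<beta> \<alpha>" by order
  note ds = delta_star_unsaturated[OF \<alpha> less_imp_le[OF a] this]
  have "0 < a * \<delta>" using a ds(3) by (simp add: \<delta>_def)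
  then have "varrho d \<beta> (\<alpha> + \<mu> - a * \<delta>) < varrho d \<beta> (\<alpha> + \<mu>)"
    using \<alpha> \<mu> by (intro varrho_strict_mono) simp_all
  then show "0 < \<delta> \<and> ereal \<delta> \<le> varrho d \<beta> (\<alpha> + \<mu> - a * \<delta>) \<and> ereal \<delta> < varrho d \<beta> (\<alpha> + \<mu>)"
    using ds(3,4) by (simp add: \<delta>_def)
qed

lemma delta_star_eq_varrho:
  assumes a: "0 \<le> a" and ge: "ereal a * varrho d \<beta> \<alpha> \<le> ereal \<mu>" and fin: "varrho d \<beta> \<alpha> < \<infinity>"
  shows "ereal (delta_star d \<beta> \<alpha> \<mu> a) = varrho d \<beta> \<alpha>"
proof -
  obtain r where r: "varrho d \<beta> \<alpha> = ereal r" using fin varrho_pos[of \<alpha>] by (cases "varrho d \<beta> \<alpha>") auto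
  then show ?thesis using delta_star_saturated(2)[OF a r] ge by simp
qed

lemma p_PMF_saturated_formula:
  assumes \<alpha>: "\<alpha> \<le> 0" and a: "0 \<le> a" and ge: "ereal a * varrho d \<beta> \<alpha> \<le> ereal \<mu>"
  shows "p_PMF d \<beta> \<alpha> \<mu> a + ereal (p_ideal d \<beta> \<alpha>)
    = ereal (p_ideal d \<beta> \<alpha>) + ereal (\<mu>\<^sup>2) / ereal (2 * a)"
proof (cases "a = 0")
  case True
  then have "0 \<le> \<mu>" using ge by (simp add: zero_ereal_def[symmetric])
  then consider "\<mu> = 0" | "0 < \<mu>" by linarith
  then show ?thesis
  proof cases
    case 1
    then show ?thesis using ideal_gas_infimum[OF \<alpha>] True
      by (simp add: zero_ereal_def[symmetric] divide_ereal_def)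
  next
    case 2
    then show ?thesis using p_PMF_zero_coupling_pos[OF \<alpha> 2] True
      by (simp add: zero_ereal_def[symmetric] divide_ereal_def)
  qed
next
  case False
  then have a: "0 < a" using a by simp
  obtain r where r: "varrho d \<beta> \<alpha> = ereal r" "a * r \<le> \<mu>" using a ge by (rule saturatedE)
  show ?thesis using p_PMF_saturated[OF \<alpha> a r] a by simp
qed

lemma p_PMF_unsaturated_formula:
  assumes \<alpha>: "\<alpha> \<le> 0" and a: "0 \<le> a" and less: "ereal \<mu> < ereal a * varrho d \<beta> \<alpha>"
  defines "\<delta> \<equiv> delta_star d \<beta> \<alpha> \<mu> a"
  shows "p_PMF d \<beta> \<alpha> \<mu> a + ereal (p_ideal d \<beta> \<alpha>)
      = ereal (a / 2 * \<delta>\<^sup>2 + p_ideal d \<beta> (\<alpha> + \<mu> - a * \<delta>))"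
    and "ereal \<mu> / ereal a < ereal \<delta>"
proof -
  show "p_PMF d \<beta> \<alpha> \<mu> a + ereal (p_ideal d \<beta> \<alpha>)
      = ereal (a / 2 * \<delta>\<^sup>2 + p_ideal d \<beta> (\<alpha> + \<mu> - a * \<delta>))"
    using p_PMF_unsaturated[OF \<alpha> a less] by (simp add: mf_dual_def \<delta>_def add_diff_eq)
  show "ereal \<mu> / ereal a < ereal \<delta>"
    using delta_star_unsaturated(2)[OF \<alpha> a less] a
    by (cases "a = 0") (auto simp: \<delta>_def zero_ereal_def[symmetric] divide_ereal_def field_simps)
qed

lemma deriv_p_PMF:
  assumes "\<alpha> \<le> 0" "0 < a"
  shows "deriv (\<lambda>\<mu>. real_of_ereal (p_PMF d \<beta> \<alpha> \<mu> a)) \<mu> = mf_density \<alpha> \<mu> a"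
  by (rule DERIV_imp_deriv[OF p_PMF_has_derivative[OF assms]])

end

theorem proposition3p6:
  fixes d :: nat and \<beta> \<alpha> :: real
  assumes "1 \<le> d" and "0 < \<beta>" and "\<alpha> \<le> 0"
  shows
    "(\<forall>a \<mu>. 0 < a \<longrightarrow>
       (let \<delta> = delta_star d \<beta> \<alpha> \<mu> a; \<xi> = xi_PMF d \<beta> \<alpha> \<mu> a in
          (\<exists>!\<delta>'. delta_eq d \<beta> \<alpha> \<mu> a \<delta>')
        \<and> \<xi> \<in> l1_plus
        \<and> (\<forall>x\<in>l1_plus. I_PMF d \<beta> \<alpha> \<mu> a x = 0 \<longleftrightarrow> x = \<xi>)
        \<and> D \<xi> = ereal \<delta>
        \<and> (\<mu> \<le> 0 \<longrightarrow>
             0 < \<delta> \<and> ereal \<delta> \<le> varrho d \<beta> (\<alpha> + \<mu> - a * \<delta>) \<and> ereal \<delta> < varrho d \<beta> (\<alpha> + \<mu>))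
        \<and> (0 < \<mu> \<and> ereal \<mu> < ereal a * varrho d \<beta> \<alpha> \<longrightarrow>
             \<mu> / a < \<delta> \<and> ereal \<delta> < varrho d \<beta> \<alpha>)
        \<and> (0 < \<mu> \<and> ereal a * varrho d \<beta> \<alpha> \<le> ereal \<mu> \<longrightarrow> ereal \<delta> = varrho d \<beta> \<alpha>)))
   \<and> (\<forall>a \<mu>. 0 \<le> a \<longrightarrow>
       (let \<delta> = delta_star d \<beta> \<alpha> \<mu> a in
          (ereal a * varrho d \<beta> \<alpha> \<le> ereal \<mu> \<longrightarrow>
             p_PMF d \<beta> \<alpha> \<mu> a + ereal (p_ideal d \<beta> \<alpha>)
               = ereal (p_ideal d \<beta> \<alpha>) + ereal (\<mu>\<^sup>2) / ereal (2 * a)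
           \<and> (varrho d \<beta> \<alpha> < \<infinity> \<longrightarrow> ereal \<delta> = varrho d \<beta> \<alpha>))
        \<and> (ereal \<mu> < ereal a * varrho d \<beta> \<alpha> \<longrightarrow>
             p_PMF d \<beta> \<alpha> \<mu> a + ereal (p_ideal d \<beta> \<alpha>)
               = ereal (a / 2 * \<delta>\<^sup>2 + p_ideal d \<beta> (\<alpha> + \<mu> - a * \<delta>))
           \<and> ereal \<mu> / ereal a < ereal \<delta> \<and> ereal \<delta> < varrho d \<beta> \<alpha>)
        \<and> (\<alpha> = 0 \<or> ereal \<mu> \<le> ereal a * varrho d \<beta> \<alpha> \<longrightarrow>
             (\<lambda>N. log_ext (Z_PMF d \<beta> \<alpha> \<mu> a N) / ereal (\<beta> * vol d N))
               \<longlonglongrightarrow> p_PMF d \<beta> \<alpha> \<mu> a)))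
   \<and> (\<forall>a. 0 < a \<longrightarrow>
       (let f = (\<lambda>\<mu>. real_of_ereal (p_PMF d \<beta> \<alpha> \<mu> a)) in
          (\<forall>\<mu>. \<bar>p_PMF d \<beta> \<alpha> \<mu> a\<bar> \<noteq> \<infinity>)
        \<and> f C1_differentiable_on UNIV
        \<and> convex_on UNIV f
        \<and> (\<forall>\<mu>. let \<delta> = delta_star d \<beta> \<alpha> \<mu> a in
             (ereal \<mu> < ereal a * varrho d \<beta> \<alpha> \<longrightarrow>
                ereal (deriv f \<mu>) = varrho d \<beta> (\<alpha> + \<mu> - a * \<delta>)
              \<and> \<mu> / a < \<delta> \<and> ereal \<delta> < varrho d \<beta> \<alpha>)
           \<and> (ereal a * varrho d \<beta> \<alpha> \<le> ereal \<mu> \<longrightarrow>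
                deriv f \<mu> = \<mu> / a \<and> ereal \<delta> = varrho d \<beta> \<alpha>))))"
proof -
  interpret bose_gas d \<beta> using assms by unfold_locales
  note \<alpha> = \<open>\<alpha> \<le> 0\<close>
  have density: "\<mu> / a < delta_star d \<beta> \<alpha> \<mu> a" "ereal (delta_star d \<beta> \<alpha> \<mu> a) < varrho d \<beta> \<alpha>"
    if "0 < a" "ereal \<mu> < ereal a * varrho d \<beta> \<alpha>" for a \<mu>
    using delta_star_unsaturated(2,5)[OF \<alpha> _ that(2)] that(1) by (simp_all add: field_simps)
  have saturated: "ereal (delta_star d \<beta> \<alpha> \<mu> a) = varrho d \<beta> \<alpha>" "mf_density \<alpha> \<mu> a = \<mu> / a"
    if a: "0 < a" and ge: "ereal a * varrho d \<beta> \<alpha> \<le> ereal \<mu>" for a \<mu>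
  proof -
    obtain r where r: "varrho d \<beta> \<alpha> = ereal r" "a * r \<le> \<mu>" using a ge by (rule saturatedE)
    show "ereal (delta_star d \<beta> \<alpha> \<mu> a) = varrho d \<beta> \<alpha>"
      using delta_star_saturated(2)[OF less_imp_le[OF a] r] r(1) by simp
    show "mf_density \<alpha> \<mu> a = \<mu> / a" by (rule mf_density_saturated[OF a r])
  qed
  show ?thesis
  proof (intro conjI allI impI)
    fix a \<mu> :: real assume a: "0 < a"
    note PMF_minimiser[OF \<alpha> a, of \<mu>] density[OF a, of \<mu>] saturated(1)[OF a, of \<mu>]
    then show "let \<delta> = delta_star d \<beta> \<alpha> \<mu> a; \<xi> = xi_PMF d \<beta> \<alpha> \<mu> a in
          (\<exists>!\<delta>'. delta_eq d \<beta> \<alpha> \<mu> a \<delta>')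
        \<and> \<xi> \<in> l1_plus
        \<and> (\<forall>x\<in>l1_plus. I_PMF d \<beta> \<alpha> \<mu> a x = 0 \<longleftrightarrow> x = \<xi>)
        \<and> D \<xi> = ereal \<delta>
        \<and> (\<mu> \<le> 0 \<longrightarrow>
             0 < \<delta> \<and> ereal \<delta> \<le> varrho d \<beta> (\<alpha> + \<mu> - a * \<delta>) \<and> ereal \<delta> < varrho d \<beta> (\<alpha> + \<mu>))
        \<and> (0 < \<mu> \<and> ereal \<mu> < ereal a * varrho d \<beta> \<alpha> \<longrightarrow>
             \<mu> / a < \<delta> \<and> ereal \<delta> < varrho d \<beta> \<alpha>)
        \<and> (0 < \<mu> \<and> ereal a * varrho d \<beta> \<alpha> \<le> ereal \<mu> \<longrightarrow> ereal \<delta> = varrho d \<beta> \<alpha>)"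
      unfolding Let_def by blast
  next
    fix a \<mu> :: real assume a: "0 \<le> a"
    note p_PMF_saturated_formula[OF \<alpha> a, of \<mu>] delta_star_eq_varrho[OF a, of \<alpha> \<mu>]
      p_PMF_unsaturated_formula[OF \<alpha> a, of \<mu>] delta_star_unsaturated(5)[OF \<alpha> a, of \<mu>]
      log_partition_limit[OF \<alpha> a, of \<mu>]
    then show "let \<delta> = delta_star d \<beta> \<alpha> \<mu> a in
          (ereal a * varrho d \<beta> \<alpha> \<le> ereal \<mu> \<longrightarrow>
             p_PMF d \<beta> \<alpha> \<mu> a + ereal (p_ideal d \<beta> \<alpha>)
               = ereal (p_ideal d \<beta> \<alpha>) + ereal (\<mu>\<^sup>2) / ereal (2 * a)
           \<and> (varrho d \<beta> \<alpha> < \<infinity> \<longrightarrow> ereal \<delta> = varrho d \<beta> \<alpha>))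
        \<and> (ereal \<mu> < ereal a * varrho d \<beta> \<alpha> \<longrightarrow>
             p_PMF d \<beta> \<alpha> \<mu> a + ereal (p_ideal d \<beta> \<alpha>)
               = ereal (a / 2 * \<delta>\<^sup>2 + p_ideal d \<beta> (\<alpha> + \<mu> - a * \<delta>))
           \<and> ereal \<mu> / ereal a < ereal \<delta> \<and> ereal \<delta> < varrho d \<beta> \<alpha>)
        \<and> (\<alpha> = 0 \<or> ereal \<mu> \<le> ereal a * varrho d \<beta> \<alpha> \<longrightarrow>
             (\<lambda>N. log_ext (Z_PMF d \<beta> \<alpha> \<mu> a N) / ereal (\<beta> * vol d N))
               \<longlonglongrightarrow> p_PMF d \<beta> \<alpha> \<mu> a)"
      unfolding Let_def by blast
  next
    fix a :: real assume a: "0 < a"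
    have deriv: "ereal (deriv (\<lambda>\<mu>. real_of_ereal (p_PMF d \<beta> \<alpha> \<mu> a)) \<mu>)
        = varrho d \<beta> (\<alpha> + \<mu> - a * delta_star d \<beta> \<alpha> \<mu> a)"
      if "ereal \<mu> < ereal a * varrho d \<beta> \<alpha>" for \<mu>
      using mf_density_unsaturated[OF \<alpha> _ that] delta_star_unsaturated(4)[OF \<alpha> _ that] a
      by (simp add: deriv_p_PMF[OF \<alpha> a])
    show "let f = (\<lambda>\<mu>. real_of_ereal (p_PMF d \<beta> \<alpha> \<mu> a)) in
          (\<forall>\<mu>. \<bar>p_PMF d \<beta> \<alpha> \<mu> a\<bar> \<noteq> \<infinity>)
        \<and> f C1_differentiable_on UNIV
        \<and> convex_on UNIV f
        \<and> (\<forall>\<mu>. let \<delta> = delta_star d \<beta> \<alpha> \<mu> a in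
             (ereal \<mu> < ereal a * varrho d \<beta> \<alpha> \<longrightarrow>
                ereal (deriv f \<mu>) = varrho d \<beta> (\<alpha> + \<mu> - a * \<delta>)
              \<and> \<mu> / a < \<delta> \<and> ereal \<delta> < varrho d \<beta> \<alpha>)
           \<and> (ereal a * varrho d \<beta> \<alpha> \<le> ereal \<mu> \<longrightarrow>
                deriv f \<mu> = \<mu> / a \<and> ereal \<delta> = varrho d \<beta> \<alpha>))"
      unfolding Let_def
    proof (intro conjI allI impI)
      show "\<bar>p_PMF d \<beta> \<alpha> \<mu> a\<bar> \<noteq> \<infinity>" for \<mu> by (simp add: p_PMF_real[OF \<alpha> a])
    qed (use p_PMF_C1[OF \<alpha> a] p_PMF_convex[OF \<alpha> a] deriv density[OF a] saturated[OF a]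
        deriv_p_PMF[OF \<alpha> a] in simp_all)
  qed
qed

end
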